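(* Let $T$ be an $L$-theory extending $I\Sigma_1$ such that for some $K\in\mathbb{N}$ and some $\varepsilon>0$, $T$ proves: for all pairwise coprime $a,b,c$ with $a+b=c$, $c < K\,\mathrm{rad}(abc)^{1+\varepsilon}$; and $T$ proves Fermat's Last Theorem for the definable exponential $x^y$ (no $a,b,c\neq 0$ and $n>2$ with $a^n+b^n=c^n$). Then $T + \mathrm{Exp}' + (\mathrm{e5}') + (\mathrm{e8})$ proves Fermat's Last Theorem for $e$: there are no non-zero $x,y,z\in B$ and $n\in A$ with $n>2$ such that $e(x,n)+e(y,n)=e(z,n)$.
   Context: $L = \langle 0,1,+,\cdot,\le\rangle$, $L^e = \langle 0,1,+,\cdot,e,\le\rangle$ with $e$ a binary (possibly partial) function symbol. $x^y$ is the exponential $\Delta_1$-definable in $I\Sigma_1$; $\mathrm{rad}(a)$ is the product of the distinct primes dividing $a$. Presburger arithmetic $\mathrm{Pr}$: $0 \ne z+1$; $x\neq 0 \to \exists z\,(x = z+1)$; $x+z=y+z\to x=y$; $x+0=x$; associativity and commutativity of $+$; $x\le y \leftrightarrow \exists z\,(x+z=y)$; for each standard $0<n$, $\exists y\,(ny \le x < n(y+1))$. $\mathrm{Exp}'$ consists of: (e0) there is an $L$-substructure $\mathcal{A}$ of $\mathcal{B}$ (universe $A$) satisfying $\mathrm{Pr}$ with $e: B\times A\to B$; and for all $x\in B$, $y,z\in A$: (e1) $(x=1\vee y=0)\leftrightarrow e(x,y)=1$; (e2) $x\neq0\to e(x,y)\ne0$; (e3) $e(x,1)=x$; (e4) $e(x,y+z)=e(x,y)e(x,z)$.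 Further axioms: (e5') $e(xy,z)=e(x,z)\cdot e(y,z)$ for $x,y\in B$, $z\in A$; (e8) for all $x,y\in B$ and $a,b\in A$: if $x$ and $y$ are coprime, then $e(x,a)$ and $e(y,b)$ are coprime. *)

theory Defs
  imports Main
begin

datatype tm = Var nat | Zero | One | Plus tm tm | Times tm tm

datatype fm = Eq tm tm | Le tm tm | Neg fm | Conj fm fm | Disj fm fm
  | Ex nat fm | All nat fm

fun tvars :: "tm \<Rightarrow> nat set" where
  "tvars (Var i) = {i}"
| "tvars Zero = {}"
| "tvars One = {}"
| "tvars (Plus s t) = tvars s \<union> tvars t"
| "tvars (Times s t) = tvars s \<union> tvars t"

inductive delta0 :: "fm \<Rightarrow> bool" where
  "delta0 (Eq s t)"
| "delta0 (Le s t)"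
| "delta0 f \<Longrightarrow> delta0 (Neg f)"
| "delta0 f \<Longrightarrow> delta0 g \<Longrightarrow> delta0 (Conj f g)"
| "delta0 f \<Longrightarrow> delta0 g \<Longrightarrow> delta0 (Disj f g)"
| "delta0 f \<Longrightarrow> x \<notin> tvars t \<Longrightarrow> delta0 (Ex x (Conj (Le (Var x) t) f))"
| "delta0 f \<Longrightarrow> x \<notin> tvars t \<Longrightarrow> delta0 (All x (Disj (Neg (Le (Var x) t)) f))"

inductive sigma1 :: "fm \<Rightarrow> bool" where
  "delta0 f \<Longrightarrow> sigma1 f"
| "sigma1 f \<Longrightarrow> sigma1 (Ex x f)"

record 'a lstr =
  carr :: "'a set"
  zr :: 'a
  on :: 'a
  ad :: "'a \<Rightarrow> 'a \<Rightarrow> 'a"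
  ml :: "'a \<Rightarrow> 'a \<Rightarrow> 'a"
  lq :: "'a \<Rightarrow> 'a \<Rightarrow> bool"

definition wf_str :: "'a lstr \<Rightarrow> bool" where
  "wf_str M \<longleftrightarrow> zr M \<in> carr M \<and> on M \<in> carr M
     \<and> (\<forall>x\<in>carr M. \<forall>y\<in>carr M. ad M x y \<in> carr M \<and> ml M x y \<in> carr M)"

fun evalt :: "'a lstr \<Rightarrow> (nat \<Rightarrow> 'a) \<Rightarrow> tm \<Rightarrow> 'a" where
  "evalt M e (Var i) = e i"
| "evalt M e Zero = zr M"
| "evalt M e One = on M"
| "evalt M e (Plus s t) = ad M (evalt M e s) (evalt M e t)"
| "evalt M e (Times s t) = ml M (evalt M e s) (evalt M e t)"

fun sat :: "'a lstr \<Rightarrow> (nat \<Rightarrow> 'a) \<Rightarrow> fm \<Rightarrow> bool" where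
  "sat M e (Eq s t) = (evalt M e s = evalt M e t)"
| "sat M e (Le s t) = lq M (evalt M e s) (evalt M e t)"
| "sat M e (Neg f) = (\<not> sat M e f)"
| "sat M e (Conj f g) = (sat M e f \<and> sat M e g)"
| "sat M e (Disj f g) = (sat M e f \<or> sat M e g)"
| "sat M e (Ex x f) = (\<exists>a\<in>carr M. sat M (e(x := a)) f)"
| "sat M e (All x f) = (\<forall>a\<in>carr M. sat M (e(x := a)) f)"

definition env_in :: "'a lstr \<Rightarrow> (nat \<Rightarrow> 'a) \<Rightarrow> bool" where
  "env_in M e \<longleftrightarrow> (\<forall>i. e i \<in> carr M)"

definition models :: "'a lstr \<Rightarrow> fm set \<Rightarrow> bool" where
  "models M T \<longleftrightarrow> wf_str M \<and> (\<forall>f\<in>T. \<forall>e. env_in M e \<longrightarrow> sat M e f)"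

definition isQ :: "'a lstr \<Rightarrow> bool" where
  "isQ M \<longleftrightarrow> (let U = carr M; z = zr M; u = on M; p = ad M; m = ml M in
     (\<forall>x\<in>U. p x u \<noteq> z)
   \<and> (\<forall>x\<in>U. \<forall>y\<in>U. p x u = p y u \<longrightarrow> x = y)
   \<and> (\<forall>x\<in>U. x \<noteq> z \<longrightarrow> (\<exists>y\<in>U. x = p y u))
   \<and> (\<forall>x\<in>U. p x z = x)
   \<and> (\<forall>x\<in>U. \<forall>y\<in>U. p x (p y u) = p (p x y) u)
   \<and> (\<forall>x\<in>U. m x z = z)
   \<and> (\<forall>x\<in>U. \<forall>y\<in>U. m x (p y u) = p (m x y) x)
   \<and> (\<forall>x\<in>U. \<forall>y\<in>U. lq M x y \<longleftrightarrow> (\<exists>w\<in>U. p x w = y)))"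

definition ind_inst :: "'a lstr \<Rightarrow> fm \<Rightarrow> nat \<Rightarrow> bool" where
  "ind_inst M f x \<longleftrightarrow> (\<forall>e. env_in M e \<longrightarrow>
      sat M (e(x := zr M)) f
      \<longrightarrow> (\<forall>a\<in>carr M. sat M (e(x := a)) f \<longrightarrow> sat M (e(x := ad M a (on M))) f)
      \<longrightarrow> (\<forall>a\<in>carr M. sat M (e(x := a)) f))"

definition ISigma1 :: "'a lstr \<Rightarrow> bool" where
  "ISigma1 M \<longleftrightarrow> wf_str M \<and> isQ M \<and> (\<forall>f x. sigma1 f \<longrightarrow> ind_inst M f x)"

fun numM :: "'a lstr \<Rightarrow> nat \<Rightarrow> 'a" where
  "numM M 0 = zr M"
| "numM M (Suc n) = ad M (numM M n) (on M)"

fun pwM :: "'a lstr \<Rightarrow> 'a \<Rightarrow> nat \<Rightarrow> 'a" where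
  "pwM M x 0 = on M"
| "pwM M x (Suc n) = ml M (pwM M x n) x"

definition ltM :: "'a lstr \<Rightarrow> 'a \<Rightarrow> 'a \<Rightarrow> bool" where
  "ltM M x y \<longleftrightarrow> lq M x y \<and> x \<noteq> y"

definition dvdM :: "'a lstr \<Rightarrow> 'a \<Rightarrow> 'a \<Rightarrow> bool" where
  "dvdM M d a \<longleftrightarrow> (\<exists>k\<in>carr M. a = ml M d k)"

definition coprimeM :: "'a lstr \<Rightarrow> 'a \<Rightarrow> 'a \<Rightarrow> bool" where
  "coprimeM M x y \<longleftrightarrow> (\<forall>u\<in>carr M. dvdM M u x \<and> dvdM M u y \<longrightarrow> u = on M)"

definition primeM :: "'a lstr \<Rightarrow> 'a \<Rightarrow> bool" where
  "primeM M p \<longleftrightarrow> p \<noteq> zr M \<and> p \<noteq> on M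
     \<and> (\<forall>u\<in>carr M. dvdM M u p \<longrightarrow> u = on M \<or> u = p)"

definition squarefreeM :: "'a lstr \<Rightarrow> 'a \<Rightarrow> bool" where
  "squarefreeM M d \<longleftrightarrow> (\<forall>u\<in>carr M. dvdM M (ml M u u) d \<longrightarrow> u = on M)"

definition isRad :: "'a lstr \<Rightarrow> 'a \<Rightarrow> 'a \<Rightarrow> bool" where
  "isRad M a d \<longleftrightarrow> d \<in> carr M \<and> squarefreeM M d \<and> dvdM M d a
     \<and> (\<forall>p\<in>carr M. primeM M p \<and> dvdM M p a \<longrightarrow> dvdM M p d)"

text \<open>E is the Delta_1 (Sigma_1-graph, total) definable exponential x^y of M.\<close>
definition isExp :: "'a lstr \<Rightarrow> ('a \<Rightarrow> 'a \<Rightarrow> 'a) \<Rightarrow> bool" where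
  "isExp M E \<longleftrightarrow>
     (\<forall>x\<in>carr M. \<forall>y\<in>carr M. E x y \<in> carr M)
   \<and> (\<exists>f. sigma1 f \<and> (\<forall>e. env_in M e \<longrightarrow> (sat M e f \<longleftrightarrow> E (e 0) (e 1) = e 2)))
   \<and> (\<forall>x\<in>carr M. E x (zr M) = on M)
   \<and> (\<forall>x\<in>carr M. \<forall>y\<in>carr M. E x (ad M y (on M)) = ml M (E x y) x)"

text \<open>abc with constant K and exponent 1 + p/q: c^q < K^q rad(abc)^(q+p).\<close>
definition abc_holds :: "'a lstr \<Rightarrow> nat \<Rightarrow> nat \<Rightarrow> nat \<Rightarrow> bool" where
  "abc_holds M K p q \<longleftrightarrow> (\<forall>a\<in>carr M. \<forall>b\<in>carr M. \<forall>c\<in>carr M. \<forall>d\<in>carr M.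
     coprimeM M a b \<and> coprimeM M b c \<and> coprimeM M a c \<and> ad M a b = c
     \<and> isRad M (ml M (ml M a b) c) d
     \<longrightarrow> ltM M (pwM M c q) (ml M (pwM M (numM M K) q) (pwM M d (q + p))))"

definition flt_exp :: "'a lstr \<Rightarrow> bool" where
  "flt_exp M \<longleftrightarrow> (\<forall>E. isExp M E \<longrightarrow>
     (\<forall>a\<in>carr M. \<forall>b\<in>carr M. \<forall>c\<in>carr M. \<forall>n\<in>carr M.
        a \<noteq> zr M \<and> b \<noteq> zr M \<and> c \<noteq> zr M \<and> ltM M (numM M 2) n
        \<longrightarrow> ad M (E a n) (E b n) \<noteq> E c n))"

definition presb_sub :: "'a lstr \<Rightarrow> 'a set \<Rightarrow> bool" where
  "presb_sub M A \<longleftrightarrow> A \<subseteq> carr M \<and> zr M \<in> A \<and> on M \<in> A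
   \<and> (\<forall>x\<in>A. \<forall>y\<in>A. ad M x y \<in> A \<and> ml M x y \<in> A)
   \<and> (\<forall>z\<in>A. zr M \<noteq> ad M z (on M))
   \<and> (\<forall>x\<in>A. x \<noteq> zr M \<longrightarrow> (\<exists>z\<in>A. x = ad M z (on M)))
   \<and> (\<forall>x\<in>A. \<forall>y\<in>A. \<forall>z\<in>A. ad M x z = ad M y z \<longrightarrow> x = y)
   \<and> (\<forall>x\<in>A. ad M x (zr M) = x)
   \<and> (\<forall>x\<in>A. \<forall>y\<in>A. \<forall>z\<in>A. ad M (ad M x y) z = ad M x (ad M y z))
   \<and> (\<forall>x\<in>A. \<forall>y\<in>A. ad M x y = ad M y x)
   \<and> (\<forall>x\<in>A. \<forall>y\<in>A. lq M x y \<longleftrightarrow> (\<exists>z\<in>A. ad M x z = y))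
   \<and> (\<forall>n::nat. 0 < n \<longrightarrow> (\<forall>x\<in>A. \<exists>y\<in>A.
        lq M (ml M (numM M n) y) x \<and> ltM M x (ml M (numM M n) (ad M y (on M)))))"

definition ExpPrime :: "'a lstr \<Rightarrow> 'a set \<Rightarrow> ('a \<Rightarrow> 'a \<Rightarrow> 'a) \<Rightarrow> bool" where
  "ExpPrime M A e \<longleftrightarrow> presb_sub M A
   \<and> (\<forall>x\<in>carr M. \<forall>y\<in>A. e x y \<in> carr M)
   \<and> (\<forall>x\<in>carr M. \<forall>y\<in>A. (x = on M \<or> y = zr M) \<longleftrightarrow> e x y = on M)
   \<and> (\<forall>x\<in>carr M. \<forall>y\<in>A. x \<noteq> zr M \<longrightarrow> e x y \<noteq> zr M)
   \<and> (\<forall>x\<in>carr M. e x (on M) = x)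
   \<and> (\<forall>x\<in>carr M. \<forall>y\<in>A. \<forall>z\<in>A. e x (ad M y z) = ml M (e x y) (e x z))"

definition e5' :: "'a lstr \<Rightarrow> 'a set \<Rightarrow> ('a \<Rightarrow> 'a \<Rightarrow> 'a) \<Rightarrow> bool" where
  "e5' M A e \<longleftrightarrow> (\<forall>x\<in>carr M. \<forall>y\<in>carr M. \<forall>z\<in>A. e (ml M x y) z = ml M (e x z) (e y z))"

definition e8 :: "'a lstr \<Rightarrow> 'a set \<Rightarrow> ('a \<Rightarrow> 'a \<Rightarrow> 'a) \<Rightarrow> bool" where
  "e8 M A e \<longleftrightarrow> (\<forall>x\<in>carr M. \<forall>y\<in>carr M. \<forall>a\<in>A. \<forall>b\<in>A.
     coprimeM M x y \<longrightarrow> coprimeM M (e x a) (e y b))"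

definition flt_e :: "'a lstr \<Rightarrow> 'a set \<Rightarrow> ('a \<Rightarrow> 'a \<Rightarrow> 'a) \<Rightarrow> bool" where
  "flt_e M A e \<longleftrightarrow> \<not> (\<exists>x\<in>carr M. \<exists>y\<in>carr M. \<exists>z\<in>carr M. \<exists>n\<in>A.
     x \<noteq> zr M \<and> y \<noteq> zr M \<and> z \<noteq> zr M \<and> ltM M (numM M 2) n
     \<and> ad M (e x n) (e y n) = e z n)"

end

theory Submission
  imports Defs
begin

text \<open>
  Dividing out a greatest common factor (with (e5') and (e8)) reduces a solution of
  \<open>e(x,n) + e(y,n) = e(z,n)\<close> to one with \<open>x\<close>, \<open>y\<close> coprime; then the three powers are pairwise
  coprime by (e8). A prime dividing \<open>e(w,n)\<close> divides \<open>w\<close>, again by (e8), so the radical of the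
  product of the three powers is at most \<open>xyz\<close>, while \<open>x\<^sup>m, y\<^sup>m, z\<^sup>m \<le> e(z,n)\<close> for every standard
  \<open>m \<le> n\<close>. For \<open>n\<close> above a standard bound depending on \<open>K\<close> and \<open>\<epsilon>\<close> this contradicts abc. Below the
  bound \<open>n\<close> is standard, \<open>e(x,n)\<close> is the definable power, and FLT for the latter applies. That
  application needs the definable exponential to exist in every model of \<open>I\<Sigma>\<^sub>1\<close>; it is obtained
  by coding finite sets of pairs through divisibility by pairwise coprime moduli.
\<close>

subsection \<open>Ordered semiring laws\<close>

text \<open>Inductions on its exponent run over standard naturals; for nonstandard \<open>n\<close>
  everything comes from the algebraic laws and from coprimality, and the size of
  \<open>e(x,n)\<close> is seen only through the standard powers below it. This explains the bound
  on \<open>n\<close>. Put \<open>r = q + p\<close> and \<open>c = e(z,n)\<close> with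
  \<open>x\<close>, \<open>y\<close> coprime. If \<open>n\<close> is at least \<open>6r\<close>,
  then \<open>(xyz)^(6r)\<close> is at most \<open>c^3\<close>, so the \<open>r\<close>-th power of
  the radical is at most the square root of \<open>c\<close>, and abc forces
  \<open>c \<le> K^2\<close>. If \<open>n\<close> is also at least \<open>K^2\<close>, then
  \<open>z^(K^2)\<close> is at most \<open>c\<close>, yet exceeds \<open>K^2\<close>. Every
  induction inside the model needs an explicit formula, with bounded quantifiers apart from leading
  existential ones. The coding for the exponential is chosen to need little: membership is
  divisibility and insertion is multiplication, so Euclid's lemma and a common multiple of an
  initial segment suffice, with no simultaneous congruences to solve.\<close>

definition bEx :: "nat \<Rightarrow> tm \<Rightarrow> fm \<Rightarrow> fm" where
  "bEx x t f = Ex x (Conj (Le (Var x) t) f)"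

definition bAll :: "nat \<Rightarrow> tm \<Rightarrow> fm \<Rightarrow> fm" where
  "bAll x t f = All x (Disj (Neg (Le (Var x) t)) f)"

text \<open>Keeping the two bounded shapes of \<open>delta0\<close> folded behind names lets the
  introduction rules and the rewriting by \<open>sat_bEx\<close> and \<open>sat_bAll\<close> match
  them directly.\<close>

lemma delta0_bEx: "delta0 f \<Longrightarrow> x \<notin> tvars t \<Longrightarrow> delta0 (bEx x t f)"
  and delta0_bAll: "delta0 f \<Longrightarrow> x \<notin> tvars t \<Longrightarrow> delta0 (bAll x t f)"
  unfolding bEx_def bAll_def by (rule delta0.intros; assumption)+

lemmas delta0_intros = delta0.intros(1-5) delta0_bEx delta0_bAll

lemma evalt_upd: "x \<notin> tvars t \<Longrightarrow> evalt M (e(x := a)) t = evalt M e t"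
  by (induction t) auto

lemma sat_bEx:
  "x \<notin> tvars t \<Longrightarrow>
    sat M e (bEx x t f) \<longleftrightarrow> (\<exists>a\<in>carr M. lq M a (evalt M e t) \<and> sat M (e(x := a)) f)"
  by (simp add: bEx_def evalt_upd)

lemma sat_bAll:
  "x \<notin> tvars t \<Longrightarrow>
    sat M e (bAll x t f) \<longleftrightarrow> (\<forall>a\<in>carr M. lq M a (evalt M e t) \<longrightarrow> sat M (e(x := a)) f)"
  by (auto simp: bAll_def evalt_upd)

locale isigma1 =
  fixes M :: "'a lstr"
  assumes ISigma1: "ISigma1 M"
begin

abbreviation U :: "'a set" where "U \<equiv> carr M"
abbreviation zero ("\<zero>") where "\<zero> \<equiv> zr M"
abbreviation one ("\<one>") where "\<one> \<equiv> on M"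
abbreviation add (infixl "\<oplus>" 65) where "x \<oplus> y \<equiv> ad M x y"
abbreviation mul (infixl "\<otimes>" 70) where "x \<otimes> y \<equiv> ml M x y"
abbreviation le (infix "\<preceq>" 50) where "x \<preceq> y \<equiv> lq M x y"
abbreviation lt (infix "\<prec>" 50) where "x \<prec> y \<equiv> ltM M x y"
abbreviation divides (infix "divides" 50) where "x divides y \<equiv> dvdM M x y"
abbreviation pow (infixr "\<up>" 80) where "x \<up> k \<equiv> pwM M x k"
abbreviation num where "num k \<equiv> numM M k"

lemma zero_in [simp, intro]: "\<zero> \<in> U" and one_in [simp, intro]: "\<one> \<in> U"
  and add_in [simp, intro]: "x \<in> U \<Longrightarrow> y \<in> U \<Longrightarrow> x \<oplus> y \<in> U"
  and mul_in [simp, intro]: "x \<in> U \<Longrightarrow> y \<in> U \<Longrightarrow> x \<otimes> y \<in> U"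
  using ISigma1 by (simp_all add: ISigma1_def wf_str_def)

lemma Q: "isQ M"
  using ISigma1 by (simp add: ISigma1_def)

lemma succ_neq_zero [simp]: "x \<in> U \<Longrightarrow> x \<oplus> \<one> \<noteq> \<zero>"
  and succ_inject: "x \<in> U \<Longrightarrow> y \<in> U \<Longrightarrow> x \<oplus> \<one> = y \<oplus> \<one> \<Longrightarrow> x = y"
  and ex_pred: "x \<in> U \<Longrightarrow> x \<noteq> \<zero> \<Longrightarrow> \<exists>y\<in>U. x = y \<oplus> \<one>"
  and add_zero [simp]: "x \<in> U \<Longrightarrow> x \<oplus> \<zero> = x"
  and add_succ: "x \<in> U \<Longrightarrow> y \<in> U \<Longrightarrow> x \<oplus> (y \<oplus> \<one>) = x \<oplus> y \<oplus> \<one>"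
  and mul_zero [simp]: "x \<in> U \<Longrightarrow> x \<otimes> \<zero> = \<zero>"
  and mul_succ: "x \<in> U \<Longrightarrow> y \<in> U \<Longrightarrow> x \<otimes> (y \<oplus> \<one>) = x \<otimes> y \<oplus> x"
  and le_iff: "x \<in> U \<Longrightarrow> y \<in> U \<Longrightarrow> x \<preceq> y \<longleftrightarrow> (\<exists>w\<in>U. x \<oplus> w = y)"
  using Q by (simp_all add: isQ_def Let_def)

lemma env_in_upd [simp]: "env_in M e \<Longrightarrow> a \<in> U \<Longrightarrow> env_in M (e(i := a))"
  and env_in_zero [simp]: "env_in M (\<lambda>_. \<zero>)"
  by (auto simp: env_in_def)

lemma env_in_app: "env_in M e \<Longrightarrow> e i \<in> U"
  by (auto simp: env_in_def)

lemma evalt_in [simp]: "env_in M e \<Longrightarrow> evalt M e t \<in> U"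
  by (induction t) (auto simp: env_in_def)

text \<open>Induction for a HOL predicate \<open>P\<close>, with \<open>f\<close> only as a
  certificate of its complexity. Parameters of \<open>P\<close> sit in the environment
  \<open>e\<close>; \<open>i\<close> is the induction variable.\<close>

lemma sigma1_induct:
  assumes "sigma1 f" "env_in M e" "\<And>a. a \<in> U \<Longrightarrow> sat M (e(i := a)) f \<longleftrightarrow> P a"
    and "P \<zero>" "\<And>a. a \<in> U \<Longrightarrow> P a \<Longrightarrow> P (a \<oplus> \<one>)" "a \<in> U"
  shows "P a"
proof -
  have "ind_inst M f i" using ISigma1 assms(1) by (simp add: ISigma1_def)
  from this[unfolded ind_inst_def, rule_format, OF assms(2)] assms(3-6)
  show ?thesis by simp
qed

lemmas delta0_induct = sigma1_induct[OF sigma1.intros(1)]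

section \<open>Commutative semiring laws, by induction on atomic formulas\<close>

lemma add_assoc:
  assumes "x \<in> U" "y \<in> U" "z \<in> U" shows "x \<oplus> y \<oplus> z = x \<oplus> (y \<oplus> z)"
  by (rule delta0_induct[where i = 0 and e = "(\<lambda>_. \<zero>)(1 := x, 2 := y)" and a = z and f =
        "Eq (Plus (Plus (Var 1) (Var 2)) (Var 0)) (Plus (Var 1) (Plus (Var 2) (Var 0)))"])
     (use assms in \<open>auto intro: delta0_intros simp: add_succ\<close>)

lemma zero_add [simp]:
  assumes "x \<in> U" shows "\<zero> \<oplus> x = x"
  by (rule delta0_induct[where i = 0 and e = "\<lambda>_. \<zero>" and a = x and f =
        "Eq (Plus Zero (Var 0)) (Var 0)"])
     (use assms in \<open>auto intro: delta0_intros simp: add_succ\<close>)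

lemma one_add:
  assumes "x \<in> U" shows "\<one> \<oplus> x = x \<oplus> \<one>"
  by (rule delta0_induct[where i = 0 and e = "\<lambda>_. \<zero>" and a = x and f =
        "Eq (Plus One (Var 0)) (Plus (Var 0) One)"])
     (use assms in \<open>auto intro: delta0_intros simp: add_succ\<close>)

lemma add_comm:
  assumes "x \<in> U" "y \<in> U" shows "x \<oplus> y = y \<oplus> x"
  by (rule delta0_induct[where i = 0 and e = "(\<lambda>_. \<zero>)(1 := x)" and a = y and f =
        "Eq (Plus (Var 1) (Var 0)) (Plus (Var 0) (Var 1))"])
     (use assms in \<open>auto intro: delta0_intros simp: add_assoc one_add\<close>, metis add_assoc add_in one_in)

lemma add_lcomm:
  "x \<in> U \<Longrightarrow> y \<in> U \<Longrightarrow> z \<in> U \<Longrightarrow> x \<oplus> (y \<oplus> z) = y \<oplus> (x \<oplus> z)"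
  by (metis add_assoc add_comm)

lemmas add_ac = add_assoc add_comm add_lcomm

lemma add_cancel:
  assumes "x \<in> U" "y \<in> U" "z \<in> U" "x \<oplus> z = y \<oplus> z" shows "x = y"
proof -
  have "x \<oplus> z = y \<oplus> z \<longrightarrow> x = y"
    by (rule delta0_induct[where i = 0 and e = "(\<lambda>_. \<zero>)(1 := x, 2 := y)" and a = z and f =
          "Disj (Neg (Eq (Plus (Var 1) (Var 0)) (Plus (Var 2) (Var 0)))) (Eq (Var 1) (Var 2))"])
       (use assms in \<open>auto intro: delta0_intros simp: add_succ dest: succ_inject[rotated 2]\<close>)
  with assms show ?thesis by simp
qed

lemma add_right_cancel [simp]: "x \<in> U \<Longrightarrow> y \<in> U \<Longrightarrow> z \<in> U \<Longrightarrow> x \<oplus> z = y \<oplus> z \<longleftrightarrow> x = y"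
  and add_left_cancel [simp]: "x \<in> U \<Longrightarrow> y \<in> U \<Longrightarrow> z \<in> U \<Longrightarrow> z \<oplus> x = z \<oplus> y \<longleftrightarrow> x = y"
  using add_cancel[of x y z] by (auto simp: add_comm)

lemma add_eq_zero: "x \<in> U \<Longrightarrow> y \<in> U \<Longrightarrow> x \<oplus> y = \<zero> \<Longrightarrow> y = \<zero>"
proof (rule ccontr)
  assume *: "x \<in> U" "y \<in> U" "x \<oplus> y = \<zero>" "y \<noteq> \<zero>"
  then obtain w where "w \<in> U" "y = w \<oplus> \<one>" using ex_pred by blast
  with * show False using add_succ[of x w] succ_neq_zero[of "x \<oplus> w"] by simp
qed

lemma add_eq_self [simp]: "x \<in> U \<Longrightarrow> y \<in> U \<Longrightarrow> x \<oplus> y = x \<longleftrightarrow> y = \<zero>"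
  using add_left_cancel[of y \<zero> x] by (simp del: add_left_cancel)

lemma distrib_left:
  assumes "x \<in> U" "y \<in> U" "z \<in> U" shows "x \<otimes> (y \<oplus> z) = x \<otimes> y \<oplus> x \<otimes> z"
  by (rule delta0_induct[where i = 0 and e = "(\<lambda>_. \<zero>)(1 := x, 2 := y)" and a = z and f =
        "Eq (Times (Var 1) (Plus (Var 2) (Var 0)))
            (Plus (Times (Var 1) (Var 2)) (Times (Var 1) (Var 0)))"])
     (use assms in \<open>auto intro: delta0_intros simp: mul_succ simp flip: add_assoc\<close>)

lemma mul_one [simp]: "x \<in> U \<Longrightarrow> x \<otimes> \<one> = x"
  using mul_succ[of x \<zero>] by simp

lemma mul_assoc:
  assumes "x \<in> U" "y \<in> U" "z \<in> U" shows "x \<otimes> y \<otimes> z = x \<otimes> (y \<otimes> z)"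
  by (rule delta0_induct[where i = 0 and e = "(\<lambda>_. \<zero>)(1 := x, 2 := y)" and a = z and f =
        "Eq (Times (Times (Var 1) (Var 2)) (Var 0)) (Times (Var 1) (Times (Var 2) (Var 0)))"])
     (use assms in \<open>auto intro: delta0_intros simp: mul_succ distrib_left\<close>)

lemma distrib_right:
  assumes "x \<in> U" "y \<in> U" "z \<in> U" shows "(x \<oplus> y) \<otimes> z = x \<otimes> z \<oplus> y \<otimes> z"
  by (rule delta0_induct[where i = 0 and e = "(\<lambda>_. \<zero>)(1 := x, 2 := y)" and a = z and f =
        "Eq (Times (Plus (Var 1) (Var 2)) (Var 0))
            (Plus (Times (Var 1) (Var 0)) (Times (Var 2) (Var 0)))"])
     (use assms in \<open>auto intro: delta0_intros simp: mul_succ add_ac\<close>)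

lemma zero_mul [simp]:
  assumes "x \<in> U" shows "\<zero> \<otimes> x = \<zero>"
  by (rule delta0_induct[where i = 0 and e = "\<lambda>_. \<zero>" and a = x and f =
        "Eq (Times Zero (Var 0)) Zero"])
     (use assms in \<open>auto intro: delta0_intros simp: mul_succ\<close>)

lemma one_mul [simp]:
  assumes "x \<in> U" shows "\<one> \<otimes> x = x"
  by (rule delta0_induct[where i = 0 and e = "\<lambda>_. \<zero>" and a = x and f =
        "Eq (Times One (Var 0)) (Var 0)"])
     (use assms in \<open>auto intro: delta0_intros simp: mul_succ\<close>)

lemma mul_comm:
  assumes "x \<in> U" "y \<in> U" shows "x \<otimes> y = y \<otimes> x"
  by (rule delta0_induct[where i = 0 and e = "(\<lambda>_. \<zero>)(1 := x)" and a = y and f =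
        "Eq (Times (Var 1) (Var 0)) (Times (Var 0) (Var 1))"])
     (use assms in \<open>auto intro: delta0_intros simp: mul_succ distrib_right\<close>)

lemma mul_lcomm:
  "x \<in> U \<Longrightarrow> y \<in> U \<Longrightarrow> z \<in> U \<Longrightarrow> x \<otimes> (y \<otimes> z) = y \<otimes> (x \<otimes> z)"
  by (metis mul_assoc mul_comm)

lemmas mul_ac = mul_assoc mul_comm mul_lcomm

lemmas semiring_simps = add_ac mul_ac distrib_left distrib_right

lemma one_neq_zero [simp]: "\<one> \<noteq> \<zero>"
  using succ_neq_zero[of \<zero>] by simp

section \<open>The discrete linear order\<close>

lemma zero_le [simp]: "x \<in> U \<Longrightarrow> \<zero> \<preceq> x"
  and le_add1 [simp]: "x \<in> U \<Longrightarrow> y \<in> U \<Longrightarrow> x \<preceq> x \<oplus> y"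
  and le_add2 [simp]: "x \<in> U \<Longrightarrow> y \<in> U \<Longrightarrow> x \<preceq> y \<oplus> x"
  by (auto simp: le_iff) (metis add_comm)

lemma le_refl [simp]: "x \<in> U \<Longrightarrow> x \<preceq> x"
  using le_add1[of x \<zero>] by simp

lemma le_trans: "x \<preceq> y \<Longrightarrow> y \<preceq> z \<Longrightarrow> x \<in> U \<Longrightarrow> y \<in> U \<Longrightarrow> z \<in> U \<Longrightarrow> x \<preceq> z"
  by (auto simp: le_iff add_assoc)

lemma le_antisym: "x \<preceq> y \<Longrightarrow> y \<preceq> x \<Longrightarrow> x \<in> U \<Longrightarrow> y \<in> U \<Longrightarrow> x = y"
proof -
  assume *: "x \<preceq> y" "y \<preceq> x" "x \<in> U" "y \<in> U"
  then obtain v w where "v \<in> U" "w \<in> U" "x \<oplus> v = y" "y \<oplus> w = x" by (auto simp: le_iff)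
  then have "x \<oplus> (v \<oplus> w) = x" using * by (simp flip: add_assoc)
  then have "w = \<zero>" using * \<open>v \<in> U\<close> \<open>w \<in> U\<close> add_eq_zero[of v w] by simp
  then show "x = y" using \<open>y \<oplus> w = x\<close> * by simp
qed

lemma le_zero [simp]: "x \<in> U \<Longrightarrow> x \<preceq> \<zero> \<longleftrightarrow> x = \<zero>"
  using le_antisym[of x \<zero>] by auto

lemma le_total:
  assumes "x \<in> U" "y \<in> U" shows "x \<preceq> y \<or> y \<preceq> x"
proof (rule delta0_induct[where i = 0 and e = "(\<lambda>_. \<zero>)(1 := x)" and a = y and f =
        "Disj (Le (Var 1) (Var 0)) (Le (Var 0) (Var 1))"])
  fix a assume a: "a \<in> U" and "x \<preceq> a \<or> a \<preceq> x"
  then consider "x \<preceq> a" | w where "w \<in> U" "a \<oplus> w = x"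
    using assms by (auto simp: le_iff)
  then show "x \<preceq> a \<oplus> \<one> \<or> a \<oplus> \<one> \<preceq> x"
  proof cases
    case 1 then show ?thesis using a assms le_trans[of x a "a \<oplus> \<one>"] by simp
  next
    case 2
    then show ?thesis
    proof (cases "w = \<zero>")
      case False
      then obtain v where "v \<in> U" "w = v \<oplus> \<one>" using ex_pred 2 by blast
      then have "a \<oplus> \<one> \<oplus> v = x" using 2 a by (simp add: add_ac)
      then show ?thesis using a assms \<open>v \<in> U\<close> by (auto simp: le_iff)
    qed (use 2 a in auto)
  qed
qed (use assms in \<open>auto intro: delta0_intros\<close>)

lemma not_le: "x \<in> U \<Longrightarrow> y \<in> U \<Longrightarrow> \<not> x \<preceq> y \<longleftrightarrow> y \<prec> x"
  unfolding ltM_def using le_total[of x y] le_antisym[of x y] le_refl[of x] by blast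

text \<open>Discreteness: a nonzero difference is a successor. This trades strict inequalities for
  inequalities that can be added and multiplied.\<close>

lemma lt_iff:
  assumes "x \<in> U" "y \<in> U" shows "x \<prec> y \<longleftrightarrow> x \<oplus> \<one> \<preceq> y"
proof
  assume "x \<prec> y"
  then obtain w where w: "w \<in> U" "x \<oplus> w = y" and "x \<noteq> y"
    using assms by (auto simp: ltM_def le_iff)
  then have "w \<noteq> \<zero>" using assms by auto
  with w ex_pred obtain v where v: "v \<in> U" "w = v \<oplus> \<one>" by blast
  with w assms have "x \<oplus> \<one> \<oplus> v = y" by (simp add: add_assoc one_add)
  with v assms show "x \<oplus> \<one> \<preceq> y" by (auto simp: le_iff)
next
  assume "x \<oplus> \<one> \<preceq> y"
  then obtain v where v: "v \<in> U" "x \<oplus> \<one> \<oplus> v = y" using assms by (auto simp: le_iff)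
  with assms have eq: "x \<oplus> (v \<oplus> \<one>) = y" by (simp add: add_assoc one_add)
  moreover have "x \<oplus> (v \<oplus> \<one>) \<noteq> x" using v assms by (subst add_eq_self) auto
  ultimately show "x \<prec> y" using v assms le_add1[of x "v \<oplus> \<one>"] by (auto simp: ltM_def)
qed

lemma succ_le_succ [simp]:
  assumes "x \<in> U" "y \<in> U" shows "x \<oplus> \<one> \<preceq> y \<oplus> \<one> \<longleftrightarrow> x \<preceq> y"
proof
  assume "x \<oplus> \<one> \<preceq> y \<oplus> \<one>"
  then obtain w where w: "w \<in> U" "x \<oplus> \<one> \<oplus> w = y \<oplus> \<one>" using assms by (auto simp: le_iff)
  then have "(x \<oplus> w) \<oplus> \<one> = y \<oplus> \<one>" using assms by (simp add: add_ac)
  then have "x \<oplus> w = y" using assms w succ_inject[of "x \<oplus> w" y] by simp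
  then show "x \<preceq> y" using assms w by (auto simp: le_iff)
next
  assume "x \<preceq> y"
  then obtain w where w: "w \<in> U" "x \<oplus> w = y" using assms by (auto simp: le_iff)
  then have "x \<oplus> \<one> \<oplus> w = y \<oplus> \<one>" using assms by (auto simp: add_ac)
  then show "x \<oplus> \<one> \<preceq> y \<oplus> \<one>" using assms w by (auto simp: le_iff)
qed

lemma lt_succ_iff: "x \<in> U \<Longrightarrow> y \<in> U \<Longrightarrow> x \<prec> y \<oplus> \<one> \<longleftrightarrow> x \<preceq> y"
  by (simp add: lt_iff)

lemma le_lt: "x \<in> U \<Longrightarrow> y \<in> U \<Longrightarrow> x \<preceq> y \<longleftrightarrow> x \<prec> y \<or> x = y"
  by (auto simp: ltM_def)

lemma le_succ_iff: "x \<in> U \<Longrightarrow> y \<in> U \<Longrightarrow> x \<preceq> y \<oplus> \<one> \<longleftrightarrow> x \<preceq> y \<or> x = y \<oplus> \<one>"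
  by (simp add: le_lt[of x "y \<oplus> \<one>"] lt_succ_iff)

lemma add_mono:
  "x \<preceq> y \<Longrightarrow> z \<preceq> w \<Longrightarrow> x \<in> U \<Longrightarrow> y \<in> U \<Longrightarrow> z \<in> U \<Longrightarrow> w \<in> U \<Longrightarrow> x \<oplus> z \<preceq> y \<oplus> w"
proof -
  assume *: "x \<preceq> y" "z \<preceq> w" "x \<in> U" "y \<in> U" "z \<in> U" "w \<in> U"
  then obtain s t where "s \<in> U" "t \<in> U" "x \<oplus> s = y" "z \<oplus> t = w" by (auto simp: le_iff)
  then have "x \<oplus> z \<oplus> (s \<oplus> t) = y \<oplus> w" using * by (auto simp: add_ac)
  then show ?thesis using * \<open>s \<in> U\<close> \<open>t \<in> U\<close> by (auto simp: le_iff)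
qed

lemma mul_mono1: "x \<preceq> y \<Longrightarrow> x \<in> U \<Longrightarrow> y \<in> U \<Longrightarrow> z \<in> U \<Longrightarrow> x \<otimes> z \<preceq> y \<otimes> z"
  by (auto simp: le_iff distrib_right)

lemma mul_mono:
  "x \<preceq> y \<Longrightarrow> z \<preceq> w \<Longrightarrow> x \<in> U \<Longrightarrow> y \<in> U \<Longrightarrow> z \<in> U \<Longrightarrow> w \<in> U \<Longrightarrow> x \<otimes> z \<preceq> y \<otimes> w"
  using mul_mono1[of x y z] mul_mono1[of z w y] le_trans[of "x \<otimes> z" "y \<otimes> z" "y \<otimes> w"]
  by (simp add: mul_comm)

end

subsection \<open>Divisibility and radicals\<close>

text \<open>Bounding the cofactor by the multiple keeps the formula \<open>delta0\<close>;
  \<open>k\<close> is its bound variable, to be chosen fresh by the caller.\<close>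

definition dvdf :: "nat \<Rightarrow> tm \<Rightarrow> tm \<Rightarrow> fm" where
  "dvdf k s t = bEx k t (Eq t (Times s (Var k)))"

lemma delta0_dvdf: "k \<notin> tvars t \<Longrightarrow> delta0 (dvdf k s t)"
  unfolding dvdf_def by (intro delta0_intros)

context isigma1
begin

text \<open>Induction on a bound below which \<open>P\<close> fails. Variable \<open>0\<close> holds
  the candidate and variable \<open>1\<close> the bound, which is why the truth of \<open>f\<close>
  must not depend on the value of \<open>1\<close>.\<close>

lemma least_element:
  assumes "delta0 f" "env_in M e"
    and sat: "\<And>a b. a \<in> U \<Longrightarrow> b \<in> U \<Longrightarrow> sat M (e(1 := b, 0 := a)) f \<longleftrightarrow> P a"
    and "a \<in> U" "P a"
  obtains m where "m \<in> U" "P m" "\<And>b. b \<in> U \<Longrightarrow> P b \<Longrightarrow> m \<preceq> b"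
proof (rule ccontr)
  assume none: "\<not> thesis"
  have "\<forall>b\<in>U. b \<preceq> a \<longrightarrow> \<not> P b"
  proof (rule delta0_induct[where i = 1 and e = e and a = a and f = "bAll 0 (Var 1) (Neg f)"])
    show "delta0 (bAll 0 (Var 1) (Neg f))" using assms(1) by (intro delta0_intros) simp_all
  next
    fix x assume "x \<in> U"
    then show "sat M (e(1 := x)) (bAll 0 (Var 1) (Neg f)) \<longleftrightarrow> (\<forall>b\<in>U. b \<preceq> x \<longrightarrow> \<not> P b)"
      using sat[of _ x] by (simp add: sat_bAll)
  next
    have "\<not> P \<zero>" using none that[of \<zero>] by auto
    then show "\<forall>b\<in>U. b \<preceq> \<zero> \<longrightarrow> \<not> P b" by auto
  next
    fix x assume x: "x \<in> U" and IH: "\<forall>b\<in>U. b \<preceq> x \<longrightarrow> \<not> P b"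
    \<comment> \<open>All elements of \<open>P\<close> lie above \<open>x\<close>, so
      \<open>x \<oplus> \<one>\<close> would be the least one if it satisfied
      \<open>P\<close>.\<close>
    have "x \<oplus> \<one> \<preceq> b" if "b \<in> U" "P b" for b
      using IH that x not_le[of b x] lt_iff[of x b] by blast
    then have "\<not> P (x \<oplus> \<one>)" using none that[of "x \<oplus> \<one>"] x by auto
    then show "\<forall>b\<in>U. b \<preceq> x \<oplus> \<one> \<longrightarrow> \<not> P b" using IH x by (auto simp: le_succ_iff)
  qed (use assms in auto)
  with assms show False by auto
qed

lemma mul_eq_zero [simp]: "x \<in> U \<Longrightarrow> y \<in> U \<Longrightarrow> x \<otimes> y = \<zero> \<longleftrightarrow> x = \<zero> \<or> y = \<zero>"
proof -
  assume *: "x \<in> U" "y \<in> U"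
  { assume "x \<otimes> y = \<zero>" "y \<noteq> \<zero>"
    with ex_pred * obtain w where "w \<in> U" "y = w \<oplus> \<one>" by blast
    then have "x = \<zero>" using \<open>x \<otimes> y = \<zero>\<close> * add_eq_zero[of "x \<otimes> w" x] by (simp add: mul_succ) }
  with * show ?thesis by auto
qed

lemma le_mul: "x \<in> U \<Longrightarrow> y \<in> U \<Longrightarrow> y \<noteq> \<zero> \<Longrightarrow> x \<preceq> x \<otimes> y"
  using ex_pred[of y] by (auto simp: mul_succ)

lemma le_mul': "x \<in> U \<Longrightarrow> y \<in> U \<Longrightarrow> y \<noteq> \<zero> \<Longrightarrow> x \<preceq> y \<otimes> x"
  by (simp add: le_mul mul_comm[of y x])

lemma one_le: "x \<in> U \<Longrightarrow> x \<noteq> \<zero> \<Longrightarrow> \<one> \<preceq> x"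
  using le_mul[of \<one> x] by simp

lemma mul_cancel_le:
  assumes "x \<in> U" "y \<in> U" "z \<in> U" "z \<noteq> \<zero>" "x \<otimes> z = y \<otimes> z" "x \<preceq> y" shows "x = y"
proof -
  obtain w where w: "w \<in> U" "x \<oplus> w = y" using assms(1,2,6) le_iff by blast
  have "x \<otimes> z \<oplus> w \<otimes> z = y \<otimes> z" using w assms(1,3) by (simp flip: distrib_right)
  then have "x \<otimes> z \<oplus> w \<otimes> z = x \<otimes> z" using assms(5) by simp
  then have "w \<otimes> z = \<zero>" using assms(1,3) w(1) by simp
  then have "w = \<zero>" using assms(3,4) w(1) by simp
  with w assms(1) show ?thesis by simp
qed

lemma mul_cancel_right:
  assumes "x \<in> U" "y \<in> U" "z \<in> U" "z \<noteq> \<zero>" "x \<otimes> z = y \<otimes> z" shows "x = y"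
  using assms le_total[of x y] mul_cancel_le[of x y z] mul_cancel_le[of y x z] by auto

lemma mul_cancel_left:
  assumes "x \<in> U" "y \<in> U" "z \<in> U" "z \<noteq> \<zero>" "z \<otimes> x = z \<otimes> y" shows "x = y"
  using assms mul_cancel_right[of x y z] by (simp add: mul_comm)

lemma mul_eq_one:
  assumes "x \<in> U" "y \<in> U" "x \<otimes> y = \<one>" shows "x = \<one>"
proof -
  have "x \<noteq> \<zero>" "y \<noteq> \<zero>" using assms one_neq_zero by force+
  then have "\<one> \<preceq> x" "x \<preceq> \<one>" using assms le_mul[of x y] one_le by auto
  then show ?thesis using assms le_antisym by blast
qed

section \<open>Divisibility without subtraction\<close>

lemma dvd_mul1 [simp]: "a \<in> U \<Longrightarrow> b \<in> U \<Longrightarrow> a divides a \<otimes> b"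
  by (auto simp: dvdM_def)

lemma dvd_mul2 [simp]: "a \<in> U \<Longrightarrow> b \<in> U \<Longrightarrow> a divides b \<otimes> a"
  using dvd_mul1[of a b] by (simp add: mul_comm)

lemma dvd_refl [simp]: "a \<in> U \<Longrightarrow> a divides a"
  using dvd_mul1[of a \<one>] by simp

lemma one_dvd [simp]: "a \<in> U \<Longrightarrow> \<one> divides a"
  using dvd_mul1[of \<one> a] by simp

lemma dvd_zero [simp]: "a \<in> U \<Longrightarrow> a divides \<zero>"
  using dvd_mul1[of a \<zero>] by simp

lemma dvd_trans: "a divides b \<Longrightarrow> b divides c \<Longrightarrow> a \<in> U \<Longrightarrow> a divides c"
  unfolding dvdM_def by (auto simp: mul_assoc)

lemma dvd_mult1: "a divides b \<Longrightarrow> c \<in> U \<Longrightarrow> a \<in> U \<Longrightarrow> a divides b \<otimes> c"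
  unfolding dvdM_def by (auto simp: mul_assoc)

lemma dvd_add: "a divides b \<Longrightarrow> a divides c \<Longrightarrow> a \<in> U \<Longrightarrow> a divides b \<oplus> c"
  unfolding dvdM_def by (auto simp flip: distrib_left)

lemma dvd_le: "a divides b \<Longrightarrow> a \<in> U \<Longrightarrow> b \<noteq> \<zero> \<Longrightarrow> a \<preceq> b"
  unfolding dvdM_def by (auto simp: le_mul)

lemma dvd_one: "a \<in> U \<Longrightarrow> a divides \<one> \<Longrightarrow> a = \<one>"
  unfolding dvdM_def using mul_eq_one[of a] by fastforce

text \<open>The difference of the two cofactors must be obtained from the order. The cofactor of
  \<open>b \<oplus> c\<close> is the larger one unless \<open>b \<oplus> c \<preceq> b\<close>, and
  then \<open>c\<close> is zero.\<close>

lemma dvd_add_cancel: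
  assumes "a divides b \<oplus> c" "a divides b" "a \<in> U" "b \<in> U" "c \<in> U" shows "a divides c"
proof (cases "b \<oplus> c \<preceq> b")
  case True
  then have "b \<oplus> c = b" using assms le_antisym[of b "b \<oplus> c"] by simp
  then show ?thesis using assms by simp
next
  case False
  obtain k l where kl: "k \<in> U" "l \<in> U" "b \<oplus> c = a \<otimes> k" "b = a \<otimes> l"
    using assms by (auto simp: dvdM_def)
  then have "\<not> k \<preceq> l" using assms False mul_mono[of a a k l] by auto
  then have "l \<preceq> k" using kl le_total by blast
  then obtain w where w: "w \<in> U" "k = l \<oplus> w" using kl by (auto simp: le_iff)
  then have "b \<oplus> c = b \<oplus> a \<otimes> w" using kl assms by (simp add: distrib_left)
  then have "c = a \<otimes> w" using assms w by simp
  then show ?thesis using w by (auto simp: dvdM_def)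
qed

lemma dvd_add_cancel2:
  assumes "a divides b \<oplus> c" "a divides c" "a \<in> U" "b \<in> U" "c \<in> U" shows "a divides b"
  using dvd_add_cancel[of a c b] assms by (simp add: add_comm)

lemma dvd_bounded:
  assumes "a \<in> U" "b \<in> U" shows "(\<exists>k\<in>U. k \<preceq> b \<and> b = a \<otimes> k) \<longleftrightarrow> a divides b"
proof
  assume "a divides b"
  then obtain k where k: "k \<in> U" "b = a \<otimes> k" by (auto simp: dvdM_def)
  show "\<exists>k\<in>U. k \<preceq> b \<and> b = a \<otimes> k"
  proof (cases "a = \<zero>")
    \<comment> \<open>Here \<open>b\<close> is zero too, and the given cofactor may exceed it;
      \<open>\<zero>\<close> is a cofactor within the bound.\<close>
    case True with k show ?thesis by (intro bexI[of _ \<zero>]) auto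
  next
    case False with k assms show ?thesis using le_mul'[of k a] by auto
  qed
qed (auto simp: dvdM_def)

lemma sat_dvdf:
  assumes "env_in M e" "k \<notin> tvars s" "k \<notin> tvars t"
  shows "sat M e (dvdf k s t) \<longleftrightarrow> evalt M e s divides evalt M e t"
  using assms dvd_bounded[of "evalt M e s" "evalt M e t"]
  by (simp add: dvdf_def sat_bEx evalt_upd)

lemma division:
  assumes "a \<in> U" "b \<in> U" "b \<noteq> \<zero>"
  shows "\<exists>q\<in>U. \<exists>r\<in>U. r \<preceq> b \<and> r \<noteq> b \<and> a = b \<otimes> q \<oplus> r"
proof (rule sigma1_induct[where i = 0 and e = "(\<lambda>_. \<zero>)(1 := b)" and a = a and f =
      "Ex 2 (Ex 3 (Conj (Le (Var 3) (Var 1)) (Conj (Neg (Eq (Var 3) (Var 1)))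
         (Eq (Var 0) (Plus (Times (Var 1) (Var 2)) (Var 3))))))"])
  fix a assume a: "a \<in> U" and "\<exists>q\<in>U. \<exists>r\<in>U. r \<preceq> b \<and> r \<noteq> b \<and> a = b \<otimes> q \<oplus> r"
  then obtain q r where qr: "q \<in> U" "r \<in> U" "r \<preceq> b" "r \<noteq> b" "a = b \<otimes> q \<oplus> r" by blast
  then have le: "r \<oplus> \<one> \<preceq> b" using assms lt_iff[of r b] by (simp add: ltM_def)
  show "\<exists>q\<in>U. \<exists>r\<in>U. r \<preceq> b \<and> r \<noteq> b \<and> a \<oplus> \<one> = b \<otimes> q \<oplus> r"
  proof (cases "r \<oplus> \<one> = b")
    case True
    then have "a \<oplus> \<one> = b \<otimes> (q \<oplus> \<one>) \<oplus> \<zero>" using qr assms by (simp add: mul_succ add_assoc)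
    then show ?thesis using qr assms
      by (intro bexI[of _ "q \<oplus> \<one>"] bexI[of _ \<zero>]) (auto dest: sym)
  next
    case False
    have "a \<oplus> \<one> = b \<otimes> q \<oplus> (r \<oplus> \<one>)" using qr assms by (simp add: add_assoc)
    then show ?thesis using qr False le by (intro bexI[of _ q] bexI[of _ "r \<oplus> \<one>"]) auto
  qed
next
  show "\<exists>q\<in>U. \<exists>r\<in>U. r \<preceq> b \<and> r \<noteq> b \<and> \<zero> = b \<otimes> q \<oplus> r"
    using assms by (intro bexI[of _ \<zero>]) auto
qed (use assms in \<open>auto intro!: sigma1.intros(2) sigma1.intros(1)[OF delta0_intros(4)] delta0_intros\<close>)

section \<open>Coprimality, primes and radicals\<close>

lemma coprime_sym: "coprimeM M u v \<Longrightarrow> coprimeM M v u"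
  unfolding coprimeM_def by blast

text \<open>Euclid's lemma without Bezout coefficients, which would need negative numbers. Let
  \<open>m\<close> be the least positive number with \<open>u\<close> dividing
  \<open>m \<otimes> k\<close>. By division with remainder \<open>m\<close> divides every
  \<open>c\<close> with \<open>u\<close> dividing \<open>c \<otimes> k\<close>, in particular
  \<open>u\<close> and \<open>b\<close>; hence \<open>m\<close> is one.\<close>

lemma coprime_dvd_mul:
  assumes "u \<in> U" "b \<in> U" "k \<in> U" "coprimeM M u b" "u divides b \<otimes> k"
  shows "u divides k"
proof (cases "u = \<zero>")
  case True
  \<comment> \<open>For \<open>u = \<zero>\<close>, \<open>b\<close> itself is a common divisor of
    \<open>u\<close> and \<open>b\<close>.\<close>
  then have "b = \<one>" using assms by (auto simp: coprimeM_def)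
  with assms show ?thesis by simp
next
  case False
  define f where "f = Conj (Neg (Eq (Var 0) Zero)) (dvdf 5 (Var 2) (Times (Var 0) (Var 3)))"
  obtain m where m: "m \<in> U" "m \<noteq> \<zero> \<and> u divides m \<otimes> k"
    and least: "\<And>b. b \<in> U \<Longrightarrow> b \<noteq> \<zero> \<and> u divides b \<otimes> k \<Longrightarrow> m \<preceq> b"
  proof (rule least_element[where f = f and e = "(\<lambda>_. \<zero>)(2 := u, 3 := k)" and a = u
        and P = "\<lambda>m. m \<noteq> \<zero> \<and> u divides m \<otimes> k"])
    show "delta0 f" unfolding f_def by (intro delta0_intros delta0_dvdf) simp_all
  qed (use assms False in \<open>auto simp: f_def sat_dvdf\<close>)
  have dvd: "m divides c" if "c \<in> U" "u divides c \<otimes> k" for c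
  proof -
    obtain q r where qr: "q \<in> U" "r \<in> U" "r \<preceq> m" "r \<noteq> m" "c = m \<otimes> q \<oplus> r"
      using division[of c m] \<open>c \<in> U\<close> m by blast
    have "c \<otimes> k = m \<otimes> k \<otimes> q \<oplus> r \<otimes> k" using qr m assms by (simp add: semiring_simps)
    moreover have "u divides m \<otimes> k \<otimes> q" using m qr assms by (simp add: dvd_mult1)
    ultimately have "u divides r \<otimes> k"
      using that qr m assms dvd_add_cancel[of u "m \<otimes> k \<otimes> q" "r \<otimes> k"] by simp
    then have "r = \<zero>" using least[of r] qr m le_antisym[of r m] by blast
    with qr m show ?thesis by simp
  qed
  have "m divides u" "m divides b" using dvd assms by auto
  then have "m = \<one>" using assms m by (simp add: coprimeM_def)
  with m assms show ?thesis by simp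
qed

lemma prime_dvd_or_coprime: "primeM M p \<Longrightarrow> p \<in> U \<Longrightarrow> p divides u \<or> coprimeM M p u"
  unfolding primeM_def coprimeM_def by blast

lemma prime_dvd_mul:
  assumes "primeM M p" "p \<in> U" "u \<in> U" "v \<in> U" "p divides u \<otimes> v"
  shows "p divides u \<or> p divides v"
  using assms prime_dvd_or_coprime coprime_dvd_mul by blast

text \<open>Minimising the cofactor of a common divisor makes the two cofactors coprime.\<close>

lemma coprime_cofactors:
  assumes "x \<in> U" "y \<in> U" "x \<noteq> \<zero>"
  obtains d x' y' where "d \<in> U" "x' \<in> U" "y' \<in> U" "x = d \<otimes> x'" "y = d \<otimes> y'" "coprimeM M x' y'"
proof -
  let ?P = "\<lambda>s. \<exists>d\<in>U. d \<preceq> x \<and> (\<exists>t\<in>U. t \<preceq> y \<and> x = d \<otimes> s \<and> y = d \<otimes> t)"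
  define f where "f = bEx 4 (Var 2) (bEx 5 (Var 3)
    (Conj (Eq (Var 2) (Times (Var 4) (Var 0))) (Eq (Var 3) (Times (Var 4) (Var 5)))))"
  have PI: "?P s" if "d \<in> U" "t \<in> U" "s \<in> U" "x = d \<otimes> s" "y = d \<otimes> t" for d s t
  proof -
    have "d \<noteq> \<zero>" "s \<noteq> \<zero>" using that assms by auto
    then have "d \<preceq> x" "t \<preceq> y" using that le_mul[of d s] le_mul'[of t d] by auto
    with that show ?thesis by blast
  qed
  obtain m where m: "m \<in> U" "?P m" and least: "\<And>b. b \<in> U \<Longrightarrow> ?P b \<Longrightarrow> m \<preceq> b"
  proof (rule least_element[where f = f and e = "(\<lambda>_. \<zero>)(2 := x, 3 := y)" and a = x and P = ?P])
    show "delta0 f" unfolding f_def by (intro delta0_intros) simp_all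
    show "?P x" using assms by (intro PI[of \<one> y x]) auto
  qed (use assms in \<open>auto simp: f_def sat_bEx\<close>)
  then obtain d t where dt: "d \<in> U" "t \<in> U" "x = d \<otimes> m" "y = d \<otimes> t" by blast
  have nz: "m \<noteq> \<zero>" using dt assms by auto
  have "coprimeM M m t"
    unfolding coprimeM_def
  proof (intro ballI impI, elim conjE)
    fix u assume u: "u \<in> U" "u divides m" "u divides t"
    then obtain m' t' where *: "m' \<in> U" "t' \<in> U" "m = u \<otimes> m'" "t = u \<otimes> t'"
      by (auto simp: dvdM_def)
    \<comment> \<open>A common factor \<open>u\<close> of the cofactors moves into the divisor
      \<open>d\<close>, making \<open>m'\<close> a candidate that is no larger than the least
      one.\<close>
    then have "?P m'" using dt u by (intro PI[of "d \<otimes> u" t' m']) (auto simp: mul_assoc)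
    then have "m \<preceq> m'" using least * by blast
    moreover have "m' \<preceq> m" using * u nz le_mul'[of m' u] by auto
    ultimately have "m = m'" using m * le_antisym by blast
    then have "u \<otimes> m = \<one> \<otimes> m" using * m by simp
    then show "u = \<one>" using mul_cancel_right[of u \<one> m] u m nz by simp
  qed
  with dt m that show thesis by blast
qed

text \<open>The least divisor of \<open>a\<close> that all primes dividing \<open>a\<close> divide is squarefree:
  a square factor \<open>u \<otimes> u\<close> could be replaced by \<open>u\<close>.\<close>

lemma ex_rad:
  assumes "a \<in> U" "a \<noteq> \<zero>"
  obtains d where "isRad M a d"
proof -
  \<comment> \<open>The bound on \<open>p\<close> makes the predicate \<open>delta0\<close>; it
    loses no prime, since divisors of the nonzero \<open>a\<close> are at most
    \<open>a\<close>.\<close>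
  let ?P = "\<lambda>d. d \<noteq> \<zero> \<and> d divides a \<and> (\<forall>p\<in>U. p \<preceq> a \<longrightarrow> primeM M p \<and> p divides a \<longrightarrow> p divides d)"
  define pr where "pr = Conj (Neg (Eq (Var 3) Zero)) (Conj (Neg (Eq (Var 3) One))
     (bAll 4 (Var 3) (Disj (Neg (dvdf 5 (Var 4) (Var 3)))
        (Disj (Eq (Var 4) One) (Eq (Var 4) (Var 3))))))"
  define f where "f = Conj (Neg (Eq (Var 0) Zero)) (Conj (dvdf 5 (Var 0) (Var 2))
     (bAll 3 (Var 2) (Disj (Neg (Conj pr (dvdf 5 (Var 3) (Var 2)))) (dvdf 5 (Var 3) (Var 0)))))"
  have pr: "sat M e pr \<longleftrightarrow> primeM M (e 3)" if "env_in M e" for e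
  proof -
    have "sat M e pr \<longleftrightarrow> e 3 \<noteq> \<zero> \<and> e 3 \<noteq> \<one>
        \<and> (\<forall>u\<in>U. u \<preceq> e 3 \<longrightarrow> u divides e 3 \<longrightarrow> u = \<one> \<or> u = e 3)"
      using that by (auto simp: pr_def sat_bAll sat_dvdf)
    also have "\<dots> \<longleftrightarrow> primeM M (e 3)"
      using dvd_le[of _ "e 3"] env_in_app[OF that] by (auto simp: primeM_def)
    finally show ?thesis .
  qed
  obtain m where m: "m \<in> U" "?P m" and least: "\<And>b. b \<in> U \<Longrightarrow> ?P b \<Longrightarrow> m \<preceq> b"
  proof (rule least_element[where f = f and e = "(\<lambda>_. \<zero>)(2 := a)" and a = a and P = ?P])
    show "delta0 f" unfolding f_def pr_def by (intro delta0_intros delta0_dvdf) simp_all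
    fix d b assume "d \<in> U" "b \<in> U"
    then show "sat M ((\<lambda>_. \<zero>)(2 := a, 1 := b, 0 := d)) f \<longleftrightarrow> ?P d"
      using assms by (simp add: f_def sat_bAll sat_dvdf pr) blast
  qed (use assms in auto)
  have "squarefreeM M m"
    unfolding squarefreeM_def
  proof (intro ballI impI)
    fix u assume u: "u \<in> U" "u \<otimes> u divides m"
    then obtain k where k: "k \<in> U" "m = u \<otimes> (u \<otimes> k)" by (auto simp: dvdM_def mul_assoc)
    then have dvd: "u \<otimes> k divides m" using u by simp
    have "p divides u \<otimes> k" if "p \<in> U" "primeM M p" "p divides m" for p
    proof -
      from that k u prime_dvd_mul[of p u "u \<otimes> k"] have "p divides u \<or> p divides u \<otimes> k" by simp
      then show ?thesis using that u k dvd_mult1[of p u k] by blast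
    qed
    moreover have "u \<otimes> k divides a" using dvd m u k dvd_trans by blast
    moreover have "u \<otimes> k \<noteq> \<zero>" using m k u by auto
    ultimately have "m \<preceq> u \<otimes> k" using m least[of "u \<otimes> k"] u k by blast
    moreover have "u \<otimes> k \<preceq> m" using dvd m u k by (auto intro: dvd_le)
    ultimately have "m = u \<otimes> k" using m u k le_antisym by blast
    then have "u \<otimes> m = \<one> \<otimes> m" using k m by simp
    then show "u = \<one>" using mul_cancel_right[of u \<one> m] u m by simp
  qed
  then have "isRad M a m" using m assms dvd_le by (auto simp: isRad_def)
  then show thesis by (rule that)
qed

end

subsection \<open>The definable exponential\<close>

text \<open>Syntactic counterpart of \<open>mem\<close>. The bound variables of \<open>memf\<close>
  and \<open>derivationf\<close> start at 21, leaving small indices free for parameters.\<close>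

definition memf :: "tm \<Rightarrow> tm \<Rightarrow> tm \<Rightarrow> tm \<Rightarrow> tm \<Rightarrow> fm" where
  "memf a b c i v = Conj (Le v c)
    (dvdf 30 (Plus One (Times b (Plus (Times i (Plus c One)) (Plus v One)))) a)"

lemma delta0_memf: "30 \<notin> tvars a \<Longrightarrow> delta0 (memf a b c i v)"
  unfolding memf_def by (intro delta0_intros delta0_dvdf)

definition derivationf :: "tm \<Rightarrow> tm \<Rightarrow> tm \<Rightarrow> tm \<Rightarrow> tm \<Rightarrow> fm" where
  "derivationf x y a b c = bAll 21 y (bAll 22 c (Disj (Neg (memf a b c (Var 21) (Var 22)))
    (Disj (Conj (Eq (Var 21) Zero) (Eq (Var 22) One))
      (bEx 23 (Var 21) (bEx 24 c (Conj (Eq (Var 21) (Plus (Var 23) One))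
        (Conj (Eq (Var 22) (Times (Var 24) x)) (memf a b c (Var 23) (Var 24)))))))))"

lemma delta0_derivationf:
  "{21, 22, 23, 24, 30} \<inter> (tvars x \<union> tvars y \<union> tvars a \<union> tvars b \<union> tvars c) = {}
    \<Longrightarrow> delta0 (derivationf x y a b c)"
  unfolding derivationf_def by (intro delta0_intros delta0_memf) auto

text \<open>Variables 0, 1, 2 are base, exponent and value, as \<open>isExp\<close> prescribes for
  the graph. Only the code of the computation is quantified without bound.\<close>

definition powf :: fm where
  "powf = Ex 3 (Ex 4 (Ex 5 (Conj (derivationf (Var 0) (Var 1) (Var 3) (Var 4) (Var 5))
    (memf (Var 3) (Var 4) (Var 5) (Var 1) (Var 2)))))"

lemma sigma1_powf: "sigma1 powf"
  unfolding powf_def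
  by (intro sigma1.intros(2) sigma1.intros(1)[OF delta0_intros(4)] delta0_derivationf delta0_memf) simp_all

context isigma1
begin

text \<open>A triple \<open>(a, b, c)\<close> codes a set of pairs \<open>(i, v)\<close> with \<open>v \<preceq> c\<close>; if \<open>b\<close> has enough divisors,
  the moduli are pairwise coprime, so that a pair is added to the set by multiplying \<open>a\<close> with
  its modulus.\<close>

definition modulus :: "'a \<Rightarrow> 'a \<Rightarrow> 'a \<Rightarrow> 'a \<Rightarrow> 'a" where
  "modulus b c i v = \<one> \<oplus> b \<otimes> (i \<otimes> (c \<oplus> \<one>) \<oplus> (v \<oplus> \<one>))"

definition mem :: "'a \<Rightarrow> 'a \<Rightarrow> 'a \<Rightarrow> 'a \<Rightarrow> 'a \<Rightarrow> bool" where
  "mem a b c i v \<longleftrightarrow> v \<preceq> c \<and> modulus b c i v divides a"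

text \<open>Up to level \<open>y\<close>, the coded set is a set of pairs \<open>(i, x\<^sup>i)\<close> that contains with every pair
  its predecessors.\<close>

definition derivation :: "'a \<Rightarrow> 'a \<Rightarrow> 'a \<Rightarrow> 'a \<Rightarrow> 'a \<Rightarrow> bool" where
  "derivation x y a b c \<longleftrightarrow> (\<forall>i\<in>U. i \<preceq> y \<longrightarrow> (\<forall>v\<in>U. v \<preceq> c \<longrightarrow> mem a b c i v \<longrightarrow>
     (i = \<zero> \<and> v = \<one>) \<or> (\<exists>j\<in>U. j \<preceq> i \<and> (\<exists>w\<in>U. w \<preceq> c \<and>
        (i = j \<oplus> \<one> \<and> v = w \<otimes> x \<and> mem a b c j w)))))"

definition is_pow :: "'a \<Rightarrow> 'a \<Rightarrow> 'a \<Rightarrow> bool" where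
  "is_pow x y z \<longleftrightarrow> (\<exists>a\<in>U. \<exists>b\<in>U. \<exists>c\<in>U. derivation x y a b c \<and> mem a b c y z)"

section \<open>Reading values off a coded computation\<close>

lemma modulus_in [simp]: "b \<in> U \<Longrightarrow> c \<in> U \<Longrightarrow> i \<in> U \<Longrightarrow> v \<in> U \<Longrightarrow> modulus b c i v \<in> U"
  by (simp add: modulus_def)

lemma mem_le: "mem a b c i v \<Longrightarrow> v \<preceq> c"
  by (simp add: mem_def)

lemma sat_memf:
  assumes "env_in M e" "30 \<notin> tvars a \<union> tvars b \<union> tvars c \<union> tvars i \<union> tvars v"
  shows "sat M e (memf a b c i v) \<longleftrightarrow>
    mem (evalt M e a) (evalt M e b) (evalt M e c) (evalt M e i) (evalt M e v)"
  using assms by (simp add: memf_def sat_dvdf mem_def modulus_def)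

lemma sat_derivationf:
  assumes "env_in M e"
    and "{21, 22, 23, 24, 30} \<inter> (tvars x \<union> tvars y \<union> tvars a \<union> tvars b \<union> tvars c) = {}"
  shows "sat M e (derivationf x y a b c) \<longleftrightarrow>
    derivation (evalt M e x) (evalt M e y) (evalt M e a) (evalt M e b) (evalt M e c)"
proof -
  have "k \<notin> tvars x" "k \<notin> tvars y" "k \<notin> tvars a" "k \<notin> tvars b" "k \<notin> tvars c"
    if "k \<in> {21, 22, 23, 24, 30}" for k
    using assms(2) that by blast+
  then show ?thesis
    using assms(1)
    by (simp add: derivationf_def derivation_def sat_bAll sat_bEx sat_memf evalt_upd)
qed

lemma sat_powf: "env_in M e \<Longrightarrow> sat M e powf \<longleftrightarrow> is_pow (e 0) (e 1) (e 2)"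
  by (simp add: powf_def is_pow_def sat_derivationf sat_memf)

lemma derivationD:
  assumes "derivation x y a b c" "i \<in> U" "i \<preceq> y" "v \<in> U" "mem a b c i v"
  shows "i = \<zero> \<and> v = \<one> \<or> (\<exists>j\<in>U. \<exists>w\<in>U. i = j \<oplus> \<one> \<and> v = w \<otimes> x \<and> mem a b c j w)"
  using assms(1)[unfolded derivation_def, rule_format, OF assms(2-4) mem_le[OF assms(5)] assms(5)]
  by blast

lemma derivation_zero:
  assumes "derivation x y a b c" "y \<in> U" "v \<in> U" "mem a b c \<zero> v" shows "v = \<one>"
proof -
  have "\<zero> \<noteq> j \<oplus> \<one>" if "j \<in> U" for j using succ_neq_zero[OF that] by simp
  with derivationD[OF assms(1) zero_in zero_le[OF assms(2)] assms(3,4)] show ?thesis by blast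
qed

lemma derivation_succ:
  assumes "derivation x y a b c" "i \<in> U" "i \<oplus> \<one> \<preceq> y" "v \<in> U" "mem a b c (i \<oplus> \<one>) v"
  obtains w where "w \<in> U" "v = w \<otimes> x" "mem a b c i w"
proof -
  have "i \<oplus> \<one> \<in> U" "i \<oplus> \<one> \<noteq> \<zero>" using assms(2) by simp_all
  with derivationD[OF assms(1) _ assms(3-5)]
  obtain j w where jw: "j \<in> U" "w \<in> U" "i \<oplus> \<one> = j \<oplus> \<one>" "v = w \<otimes> x" "mem a b c j w" by blast
  then have "i = j" using succ_inject[OF assms(2)] by simp
  with jw that show thesis by simp
qed

lemma derivation_mono:
  "derivation x y a b c \<Longrightarrow> y' \<preceq> y \<Longrightarrow> y \<in> U \<Longrightarrow> y' \<in> U \<Longrightarrow> derivation x y' a b c"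
  unfolding derivation_def using le_trans[of _ y' y] by blast

text \<open>Induction on \<open>i\<close>: both values at a successor are \<open>x\<close> times
  values at the predecessor. Two different codes give uniqueness of powers; the same code taken
  twice shows that one code holds at most one value per index. The bounds \<open>c\<close> and
  \<open>c'\<close> keep the predicate \<open>delta0\<close>.\<close>

lemma derivation_unique:
  assumes "x \<in> U" "y \<in> U" "a \<in> U" "b \<in> U" "c \<in> U" "y' \<in> U" "a' \<in> U" "b' \<in> U" "c' \<in> U"
    and "derivation x y a b c" "derivation x y' a' b' c'"
    and "i \<in> U" "i \<preceq> y" "i \<preceq> y'" "v \<in> U" "v' \<in> U" "mem a b c i v" "mem a' b' c' i v'"
  shows "v = v'"
proof -
  let ?P = "\<lambda>i. i \<preceq> y \<longrightarrow> i \<preceq> y' \<longrightarrow> (\<forall>v\<in>U. v \<preceq> c \<longrightarrow> (\<forall>v'\<in>U. v' \<preceq> c' \<longrightarrow>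
     mem a b c i v \<longrightarrow> mem a' b' c' i v' \<longrightarrow> v = v'))"
  define f where "f = Disj (Neg (Le (Var 0) (Var 1))) (Disj (Neg (Le (Var 0) (Var 2)))
     (bAll 9 (Var 5) (bAll 10 (Var 8) (Disj (Neg (memf (Var 3) (Var 4) (Var 5) (Var 0) (Var 9)))
       (Disj (Neg (memf (Var 6) (Var 7) (Var 8) (Var 0) (Var 10))) (Eq (Var 9) (Var 10)))))))"
  have "?P i"
  proof (rule delta0_induct[where i = 0 and a = i and P = ?P and f = f and e =
        "(\<lambda>_. \<zero>)(1 := y, 2 := y', 3 := a, 4 := b, 5 := c, 6 := a', 7 := b', 8 := c')"])
    show "delta0 f" unfolding f_def by (intro delta0_intros delta0_memf) simp_all
    show "?P \<zero>"
    proof (intro impI ballI)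
      fix v v' assume *: "v \<in> U" "v' \<in> U" "mem a b c \<zero> v" "mem a' b' c' \<zero> v'"
      have "v = \<one>" by (rule derivation_zero[OF assms(10,2) *(1,3)])
      moreover have "v' = \<one>" by (rule derivation_zero[OF assms(11,6) *(2,4)])
      ultimately show "v = v'" by simp
    qed
  next
    fix i assume i: "i \<in> U" and IH: "?P i"
    show "?P (i \<oplus> \<one>)"
    proof (intro impI ballI)
      fix v v' assume *: "i \<oplus> \<one> \<preceq> y" "i \<oplus> \<one> \<preceq> y'" "v \<in> U" "v' \<in> U"
        "mem a b c (i \<oplus> \<one>) v" "mem a' b' c' (i \<oplus> \<one>) v'"
      obtain w where w: "w \<in> U" "v = w \<otimes> x" "mem a b c i w"
        by (rule derivation_succ[OF assms(10) i *(1,3,5)])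
      obtain w' where w': "w' \<in> U" "v' = w' \<otimes> x" "mem a' b' c' i w'"
        by (rule derivation_succ[OF assms(11) i *(2,4,6)])
      have "i \<preceq> y" "i \<preceq> y'"
        using * i assms(2,6) le_trans[of i "i \<oplus> \<one>"] by simp_all
      then have "w = w'" using IH w w' mem_le[OF w(3)] mem_le[OF w'(3)] by blast
      with w w' show "v = v'" by simp
    qed
  next
    show "env_in M ((\<lambda>_. \<zero>)(1 := y, 2 := y', 3 := a, 4 := b, 5 := c, 6 := a', 7 := b', 8 := c'))"
      using assms(1-9) by simp
    fix i assume "i \<in> U"
    then show "sat M ((\<lambda>_. \<zero>)(1 := y, 2 := y', 3 := a, 4 := b, 5 := c, 6 := a', 7 := b', 8 := c',
        0 := i)) f \<longleftrightarrow> ?P i"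
      using assms(1-9) by (simp add: f_def sat_bAll sat_memf) blast
  qed (rule assms)
  from this[rule_format, OF assms(13-15) mem_le[OF assms(17)] assms(16) mem_le[OF assms(18)]
      assms(17,18)] show ?thesis .
qed

text \<open>The code is closed under predecessors, so the induction descends from \<open>y\<close>;
  its variable \<open>j\<close> is the distance from \<open>i\<close> to \<open>y\<close>.\<close>

lemma derivation_inhabited:
  assumes "x \<in> U" "y \<in> U" "a \<in> U" "b \<in> U" "c \<in> U" "z \<in> U"
    and deriv: "derivation x y a b c" "mem a b c y z" and i: "i \<in> U" "i \<preceq> y"
  shows "\<exists>v\<in>U. mem a b c i v"
proof -
  let ?P = "\<lambda>j. \<forall>i\<in>U. i \<preceq> y \<longrightarrow> i \<oplus> j = y \<longrightarrow> (\<exists>v\<in>U. v \<preceq> c \<and> mem a b c i v)"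
  define f where "f = bAll 5 (Var 1) (Disj (Neg (Eq (Plus (Var 5) (Var 0)) (Var 1)))
     (bEx 6 (Var 4) (memf (Var 2) (Var 3) (Var 4) (Var 5) (Var 6))))"
  obtain j where j: "j \<in> U" "i \<oplus> j = y" using i assms by (auto simp: le_iff)
  have "?P j"
  proof (rule delta0_induct[where i = 0 and a = j and P = ?P and f = f and e =
        "(\<lambda>_. \<zero>)(1 := y, 2 := a, 3 := b, 4 := c)"])
    show "delta0 f" unfolding f_def by (intro delta0_intros delta0_memf) simp_all
    show "?P \<zero>" using \<open>z \<in> U\<close> mem_le[OF deriv(2)] deriv(2) by auto
  next
    fix j assume j: "j \<in> U" and IH: "?P j"
    show "?P (j \<oplus> \<one>)"
    proof (intro impI ballI)
      fix i assume i: "i \<in> U" "i \<oplus> (j \<oplus> \<one>) = y"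
      then have y: "i \<oplus> \<one> \<oplus> j = y" using j by (simp add: add_ac)
      then have le: "i \<oplus> \<one> \<preceq> y" using i j le_add1[of "i \<oplus> \<one>" j] by simp
      with IH y i obtain v where "v \<in> U" "mem a b c (i \<oplus> \<one>) v" by blast
      from derivation_succ[OF deriv(1) i(1) le this]
      obtain w where "w \<in> U" "mem a b c i w" by blast
      then show "\<exists>v\<in>U. v \<preceq> c \<and> mem a b c i v" using mem_le by blast
    qed
  next
    show "env_in M ((\<lambda>_. \<zero>)(1 := y, 2 := a, 3 := b, 4 := c))" using assms(2-5) by simp
    fix j assume "j \<in> U"
    then show "sat M ((\<lambda>_. \<zero>)(1 := y, 2 := a, 3 := b, 4 := c, 0 := j)) f \<longleftrightarrow> ?P j"
      using assms(2-5) by (simp add: f_def sat_bAll sat_bEx sat_memf)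
  qed (rule j)
  with i j show ?thesis by blast
qed

text \<open>A substitute for the factorial, which is no more available at this stage than the
  exponential: a common multiple for \<open>n\<close> is multiplied by
  \<open>n \<oplus> \<one>\<close>.\<close>

lemma ex_common_multiple:
  assumes "n \<in> U" shows "\<exists>b\<in>U. b \<noteq> \<zero> \<and> (\<forall>d\<in>U. d \<preceq> n \<longrightarrow> d \<noteq> \<zero> \<longrightarrow> d divides b)"
proof (rule sigma1_induct[where i = 0 and a = n and e = "\<lambda>_. \<zero>" and f =
      "Ex 1 (Conj (Neg (Eq (Var 1) Zero))
         (bAll 2 (Var 0) (Disj (Eq (Var 2) Zero) (dvdf 3 (Var 2) (Var 1)))))"])
  show "sigma1 (Ex 1 (Conj (Neg (Eq (Var 1) Zero))
         (bAll 2 (Var 0) (Disj (Eq (Var 2) Zero) (dvdf 3 (Var 2) (Var 1))))))"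
    by (intro sigma1.intros(2) sigma1.intros(1)[OF delta0_intros(4)] delta0_intros delta0_dvdf)
       simp_all
next
  show "\<exists>b\<in>U. b \<noteq> \<zero> \<and> (\<forall>d\<in>U. d \<preceq> \<zero> \<longrightarrow> d \<noteq> \<zero> \<longrightarrow> d divides b)"
    by (intro bexI[of _ \<one>]) auto
next
  fix n assume n: "n \<in> U" and "\<exists>b\<in>U. b \<noteq> \<zero> \<and> (\<forall>d\<in>U. d \<preceq> n \<longrightarrow> d \<noteq> \<zero> \<longrightarrow> d divides b)"
  then obtain b where b: "b \<in> U" "b \<noteq> \<zero>" "\<forall>d\<in>U. d \<preceq> n \<longrightarrow> d \<noteq> \<zero> \<longrightarrow> d divides b" by blast
  then show "\<exists>b\<in>U. b \<noteq> \<zero> \<and> (\<forall>d\<in>U. d \<preceq> n \<oplus> \<one> \<longrightarrow> d \<noteq> \<zero> \<longrightarrow> d divides b)"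
    using n by (intro bexI[of _ "b \<otimes> (n \<oplus> \<one>)"]) (auto simp: le_succ_iff intro: dvd_mult1)
qed (use assms in \<open>auto simp: sat_bAll sat_dvdf\<close>)

text \<open>A common divisor \<open>u\<close> is coprime to \<open>b\<close>, since any divisor of
  both divides one. It divides \<open>b\<close> times the difference of \<open>k\<close> and
  \<open>l\<close>, hence the difference. That is nonzero and at most \<open>n\<close>, so it
  divides \<open>b\<close>, and \<open>u\<close> does too.\<close>

lemma coprime_moduli:
  assumes "b \<in> U" "n \<in> U" and b: "\<forall>d\<in>U. d \<preceq> n \<longrightarrow> d \<noteq> \<zero> \<longrightarrow> d divides b"
    and "k \<in> U" "l \<in> U" "k \<preceq> n" "l \<preceq> n" "k \<noteq> l"
  shows "coprimeM M (\<one> \<oplus> b \<otimes> k) (\<one> \<oplus> b \<otimes> l)"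
proof -
  have *: "coprimeM M (\<one> \<oplus> b \<otimes> k) (\<one> \<oplus> b \<otimes> l)"
    if kl: "k \<in> U" "l \<in> U" "k \<preceq> n" "l \<preceq> k" "k \<noteq> l" for k l
    unfolding coprimeM_def
  proof (intro ballI impI, elim conjE)
    fix u assume u: "u \<in> U" "u divides \<one> \<oplus> b \<otimes> k" "u divides \<one> \<oplus> b \<otimes> l"
    obtain d where d: "d \<in> U" "l \<oplus> d = k" using kl le_iff[of l k] by auto
    have "d \<noteq> \<zero>" using d kl by auto
    have "d \<preceq> n" using d kl assms(2) le_add2[of d l] le_trans[of d k n] by simp
    with d \<open>d \<noteq> \<zero>\<close> b have "d divides b" by blast
    have "\<one> \<oplus> b \<otimes> k = (\<one> \<oplus> b \<otimes> l) \<oplus> b \<otimes> d"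
      unfolding d(2)[symmetric] using d(1) kl(2) assms(1) by (simp add: distrib_left add_assoc)
    then have bd: "u divides b \<otimes> d"
      using u d(1) kl(2) assms(1) dvd_add_cancel[of u "\<one> \<oplus> b \<otimes> l" "b \<otimes> d"] by simp
    have one: "t = \<one>" if "t \<in> U" "t divides u" "t divides b" for t
    proof -
      have "t divides \<one> \<oplus> b \<otimes> l" using that u dvd_trans by blast
      moreover have "t divides b \<otimes> l" using that \<open>l \<in> U\<close> dvd_mult1 by blast
      ultimately have "t divides \<one>"
        using that assms(1) \<open>l \<in> U\<close> dvd_add_cancel2[of t \<one> "b \<otimes> l"] by simp
      then show ?thesis using that dvd_one by blast
    qed
    then have "coprimeM M u b" by (simp add: coprimeM_def)
    then have "u divides d" using bd coprime_dvd_mul u d assms(1) by blast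
    then have "u divides b" using \<open>d divides b\<close> u dvd_trans by blast
    then show "u = \<one>" using one u by simp
  qed
  show ?thesis
    using *[of k l] *[of l k] assms le_total[of k l] coprime_sym by blast
qed

text \<open>The right side is the largest index in use, reached at \<open>i = y\<close> and
  \<open>v = c\<close>; up to it every nonzero number has to divide \<open>b\<close>.\<close>

lemma index_le:
  assumes "i \<in> U" "c \<in> U" "v \<in> U" "y \<in> U" "i \<preceq> y" "v \<preceq> c"
  shows "i \<otimes> (c \<oplus> \<one>) \<oplus> (v \<oplus> \<one>) \<preceq> y \<otimes> (c \<oplus> \<one>) \<oplus> (c \<oplus> \<one>)"
  using assms by (intro add_mono mul_mono) simp_all

text \<open>Number notation in base \<open>c \<oplus> \<one>\<close>: \<open>v\<close> is the low
  digit. If \<open>i\<close> were smaller than \<open>j\<close>, the low digit would have to make up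
  for at least one full base.\<close>

lemma index_inject:
  assumes "i \<in> U" "c \<in> U" "v \<in> U" "j \<in> U" "u \<in> U" "v \<preceq> c" "u \<preceq> c"
    and "i \<otimes> (c \<oplus> \<one>) \<oplus> (v \<oplus> \<one>) = j \<otimes> (c \<oplus> \<one>) \<oplus> (u \<oplus> \<one>)"
  shows "i = j \<and> v = u"
proof -
  have *: False if ij: "i \<in> U" "j \<in> U" "v \<in> U" "u \<in> U" "v \<preceq> c" "i \<prec> j"
    and eq: "i \<otimes> (c \<oplus> \<one>) \<oplus> (v \<oplus> \<one>) = j \<otimes> (c \<oplus> \<one>) \<oplus> (u \<oplus> \<one>)" for i j u v
  proof -
    obtain w where w: "w \<in> U" "i \<oplus> \<one> \<oplus> w = j"
      using ij lt_iff[of i j] le_iff[of "i \<oplus> \<one>" j] by auto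
    define s where "s = c \<oplus> \<one>"
    have s: "s \<in> U" "v \<oplus> \<one> \<preceq> s" using that assms by (simp_all add: s_def)
    have "i \<otimes> s \<oplus> (v \<oplus> \<one>) = i \<otimes> s \<oplus> (s \<oplus> (w \<otimes> s \<oplus> u \<oplus> \<one>))"
      using eq that(1-4) w(1) s(1) unfolding s_def[symmetric] w(2)[symmetric]
      by (simp add: distrib_right add_assoc)
    then have e: "v \<oplus> \<one> = s \<oplus> (w \<otimes> s \<oplus> u \<oplus> \<one>)" using that(1-4) w(1) s(1) by simp
    then have "s \<preceq> v \<oplus> \<one>" using that(1-4) w(1) s(1) by simp
    then have "v \<oplus> \<one> = s" using s that le_antisym by blast
    with e have "s \<oplus> (w \<otimes> s \<oplus> u \<oplus> \<one>) = s" by simp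
    then show False using that(1-4) w(1) s(1) by simp
  qed
  have "i = j"
    using *[of i j v u] *[of j i u v] assms not_le[of i j] not_le[of j i] le_antisym by metis
  then show ?thesis using assms by simp
qed

text \<open>Different pairs have different indices and thus coprime moduli; by Euclid's lemma the
  new factor of \<open>a\<close> admits no pair except its own.\<close>

lemma mem_insert:
  assumes "b \<in> U" "c \<in> U" "y \<in> U" "a \<in> U"
    and b: "\<forall>d\<in>U. d \<preceq> y \<otimes> (c \<oplus> \<one>) \<oplus> (c \<oplus> \<one>) \<longrightarrow> d \<noteq> \<zero> \<longrightarrow> d divides b"
    and "i \<in> U" "v \<in> U" "i \<preceq> y" "v \<preceq> c" "j \<in> U" "u \<in> U" "j \<preceq> y"
  shows "mem (a \<otimes> modulus b c i v) b c j u \<longleftrightarrow> mem a b c j u \<or> j = i \<and> u = v"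
proof
  assume mem: "mem (a \<otimes> modulus b c i v) b c j u"
  show "mem a b c j u \<or> j = i \<and> u = v"
  proof (cases "j \<otimes> (c \<oplus> \<one>) \<oplus> (u \<oplus> \<one>) = i \<otimes> (c \<oplus> \<one>) \<oplus> (v \<oplus> \<one>)")
    case True
    then show ?thesis using index_inject[of j c u i v] assms mem_le[OF mem] by simp
  next
    case False
    have "coprimeM M (modulus b c j u) (modulus b c i v)"
      unfolding modulus_def
      using coprime_moduli[OF \<open>b \<in> U\<close> _ b _ _ _ _ False] index_le[of j c u y] index_le[of i c v y]
        assms mem_le[OF mem] by simp
    moreover have "modulus b c j u divides modulus b c i v \<otimes> a"
      using mem assms by (simp add: mem_def mul_comm)
    ultimately show ?thesis
      using mem assms coprime_dvd_mul[of "modulus b c j u" "modulus b c i v" a]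
      by (simp add: mem_def)
  qed
next
  assume "mem a b c j u \<or> j = i \<and> u = v"
  then show "mem (a \<otimes> modulus b c i v) b c j u"
    using assms by (auto simp: mem_def intro: dvd_mult1)
qed

lemma derivation_insert:
  assumes "b \<in> U" "c \<in> U" "y \<in> U" "a \<in> U"
    and b: "\<forall>d\<in>U. d \<preceq> y \<otimes> (c \<oplus> \<one>) \<oplus> (c \<oplus> \<one>) \<longrightarrow> d \<noteq> \<zero> \<longrightarrow> d divides b"
    and "i \<in> U" "v \<in> U" "i \<preceq> y" "v \<preceq> c" "derivation x y a b c"
    and pred: "i = \<zero> \<and> v = \<one> \<or> (\<exists>j\<in>U. \<exists>w\<in>U. i = j \<oplus> \<one> \<and> v = w \<otimes> x \<and> mem a b c j w)"
  shows "derivation x y (a \<otimes> modulus b c i v) b c" "mem (a \<otimes> modulus b c i v) b c i v"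
proof -
  note mem = mem_insert[OF assms(1-4) b assms(6-9)]
  show "mem (a \<otimes> modulus b c i v) b c i v" using mem[of i v] assms by simp
  show "derivation x y (a \<otimes> modulus b c i v) b c"
    unfolding derivation_def
  proof (intro ballI impI)
    fix j u assume ju: "j \<in> U" "j \<preceq> y" "u \<in> U" "mem (a \<otimes> modulus b c i v) b c j u"
    then consider "mem a b c j u" | "j = i" "u = v" using mem by blast
    then have "j = \<zero> \<and> u = \<one> \<or> (\<exists>k\<in>U. \<exists>w\<in>U. j = k \<oplus> \<one> \<and> u = w \<otimes> x \<and> mem a b c k w)"
    proof cases
      case 1
      then show ?thesis using \<open>derivation x y a b c\<close> ju mem_le unfolding derivation_def by blast
    next
      case 2
      then show ?thesis using pred by simp
    qed
    moreover have "k \<preceq> j \<and> w \<preceq> c \<and> mem (a \<otimes> modulus b c i v) b c k w"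
      if "k \<in> U" "w \<in> U" "j = k \<oplus> \<one>" "mem a b c k w" for k w
    proof -
      have "k \<preceq> j" using that by simp
      moreover from this have "k \<preceq> y" using that ju assms(3) le_trans[of k j y] by blast
      ultimately show ?thesis using mem that mem_le by blast
    qed
    ultimately show "j = \<zero> \<and> u = \<one> \<or> (\<exists>k\<in>U. k \<preceq> j \<and> (\<exists>w\<in>U. w \<preceq> c \<and>
        (j = k \<oplus> \<one> \<and> u = w \<otimes> x \<and> mem (a \<otimes> modulus b c i v) b c k w)))"
      by metis
  qed
qed

text \<open>The number \<open>\<one>\<close> codes the empty set: indices are positive because of
  the summand \<open>v \<oplus> \<one>\<close>, so with \<open>b\<close> nonzero no modulus equals
  one. The pair of \<open>\<zero>\<close> and \<open>\<one>\<close> is then inserted, for which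
  \<open>c\<close> must be at least one.\<close>

lemma derivation_start:
  assumes "b \<in> U" "c \<in> U" "y \<in> U" "b \<noteq> \<zero>" "\<one> \<preceq> c"
    and "\<forall>d\<in>U. d \<preceq> y \<otimes> (c \<oplus> \<one>) \<oplus> (c \<oplus> \<one>) \<longrightarrow> d \<noteq> \<zero> \<longrightarrow> d divides b"
  shows "\<exists>a\<in>U. derivation x y a b c \<and> mem a b c \<zero> \<one>"
proof -
  have "\<not> mem \<one> b c i v" if "i \<in> U" "v \<in> U" for i v
  proof
    assume "mem \<one> b c i v"
    then have "modulus b c i v = \<one>" using that assms dvd_one by (auto simp: mem_def)
    then have "b \<otimes> (i \<otimes> (c \<oplus> \<one>) \<oplus> (v \<oplus> \<one>)) = \<zero>"
      unfolding modulus_def using that assms by (subst (asm) add_eq_self) auto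
    then have "i \<otimes> (c \<oplus> \<one>) \<oplus> v \<oplus> \<one> = \<zero>" using that assms by (simp add: add_assoc)
    then show False using that assms succ_neq_zero[of "i \<otimes> (c \<oplus> \<one>) \<oplus> v"] by simp
  qed
  then have "derivation x y \<one> b c" by (simp add: derivation_def)
  from derivation_insert[OF assms(1-3) one_in assms(6) zero_in one_in _ assms(5) this] assms
  show ?thesis by (intro bexI[of _ "\<one> \<otimes> modulus b c \<zero> \<one>"]) simp_all
qed

text \<open>The modulus parameter has to grow with the values, so the sequence is coded anew.\<close>

lemma derivation_extend:
  assumes "x \<in> U" "y \<in> U" "a \<in> U" "b \<in> U" "c \<in> U" "z \<in> U"
    and deriv: "derivation x y a b c" "mem a b c y z"
  shows "\<exists>z'\<in>U. is_pow x (y \<oplus> \<one>) z'"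
proof -
  \<comment> \<open>A sum in place of a maximum: it bounds the old values, the new value
    \<open>z \<otimes> x\<close> and the initial value \<open>\<one>\<close>.\<close>
  define c' where "c' = c \<oplus> z \<otimes> x \<oplus> \<one>"
  have c': "c' \<in> U" "\<one> \<preceq> c'" "z \<otimes> x \<preceq> c'" "c \<preceq> c'"
    using assms le_add1[of "z \<otimes> x" "c \<oplus> \<one>"] le_add1[of c "z \<otimes> x \<oplus> \<one>"] le_add2[of \<one> "c \<oplus> z \<otimes> x"]
    by (simp_all add: c'_def add_ac)
  let ?y = "y \<oplus> \<one>"
  have y: "?y \<in> U" using assms by simp
  obtain b' where b': "b' \<in> U" "b' \<noteq> \<zero>"
    "\<forall>d\<in>U. d \<preceq> ?y \<otimes> (c' \<oplus> \<one>) \<oplus> (c' \<oplus> \<one>) \<longrightarrow> d \<noteq> \<zero> \<longrightarrow> d divides b'"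
    using ex_common_multiple[of "?y \<otimes> (c' \<oplus> \<one>) \<oplus> (c' \<oplus> \<one>)"] c' y by auto
  \<comment> \<open>The last conjunct ties each recoded value to the old code. Without it nothing
    would keep the next product within \<open>c'\<close>.\<close>
  let ?P = "\<lambda>i. i \<preceq> ?y \<longrightarrow> (\<exists>a'\<in>U. \<exists>v\<in>U. derivation x ?y a' b' c' \<and> mem a' b' c' i v
     \<and> (i \<preceq> y \<longrightarrow> mem a b c i v))"
  \<comment> \<open>The existential quantifiers stand in front of the implication, as
    \<open>sigma1\<close> requires. Moving them there needs a nonempty carrier, whence
    \<open>zero_in\<close> in the last step.\<close>
  define f where "f = Ex 9 (Ex 10 (Disj (Neg (Le (Var 0) (Plus (Var 2) One)))
     (Conj (derivationf (Var 1) (Plus (Var 2) One) (Var 9) (Var 6) (Var 7))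
       (Conj (memf (Var 9) (Var 6) (Var 7) (Var 0) (Var 10))
         (Disj (Neg (Le (Var 0) (Var 2))) (memf (Var 3) (Var 4) (Var 5) (Var 0) (Var 10)))))))"
  have "?P ?y"
  proof (rule sigma1_induct[where i = 0 and a = ?y and P = ?P and f = f and e =
        "(\<lambda>_. \<zero>)(1 := x, 2 := y, 3 := a, 4 := b, 5 := c, 6 := b', 7 := c')"])
    show "sigma1 f"
      unfolding f_def
      by (intro sigma1.intros(2) sigma1.intros(1)[OF delta0_intros(5)] delta0_intros
          delta0_derivationf delta0_memf) simp_all
  next
    obtain v where "v \<in> U" "mem a b c \<zero> v"
      using derivation_inhabited[OF assms zero_in] assms(2) by auto
    then have "mem a b c \<zero> \<one>" using derivation_zero deriv assms(2) by metis
    then show "?P \<zero>" using derivation_start[OF b'(1) c'(1) y b'(2) c'(2) b'(3), of x] by auto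
  next
    fix i assume i: "i \<in> U" and IH: "?P i"
    show "?P (i \<oplus> \<one>)"
    proof
      assume le: "i \<oplus> \<one> \<preceq> ?y"
      then have iy: "i \<preceq> y" using i assms(2) by simp
      then have "i \<preceq> ?y" using i assms(2) by (simp add: le_succ_iff)
      with IH iy obtain a' v where a': "a' \<in> U" "v \<in> U" "derivation x ?y a' b' c'"
        "mem a' b' c' i v" "mem a b c i v" by blast
      \<comment> \<open>Either \<open>i\<close> is the old end, where the value is \<open>z\<close>
        and \<open>c'\<close> was made large enough, or the product already occurs in the old code
        and is at most \<open>c\<close>.\<close>
      have "v \<otimes> x \<preceq> c' \<and> (i \<oplus> \<one> \<preceq> y \<longrightarrow> mem a b c (i \<oplus> \<one>) (v \<otimes> x))"
      proof (cases "i = y")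
        case True
        then have "v = z"
          using derivation_unique[OF assms(1-5) assms(2-5) deriv(1) deriv(1) i, of v z] a' assms by simp
        then show ?thesis using True c' lt_iff[of y y] assms(2) by (auto simp: ltM_def)
      next
        case False
        then have le': "i \<oplus> \<one> \<preceq> y" using iy i assms(2) lt_iff[of i y] by (simp add: ltM_def)
        then obtain v' where v': "v' \<in> U" "mem a b c (i \<oplus> \<one>) v'"
          using derivation_inhabited[OF assms, of "i \<oplus> \<one>"] i by auto
        then obtain w where w: "w \<in> U" "v' = w \<otimes> x" "mem a b c i w"
          using derivation_succ[OF deriv(1) i le'] by metis
        then have "w = v"
          using derivation_unique[OF assms(1-5) assms(2-5) deriv(1) deriv(1) i iy iy, of w v] a'
          by simp
        with w v' have "mem a b c (i \<oplus> \<one>) (v \<otimes> x)" by simp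
        moreover from this have "v \<otimes> x \<preceq> c'"
          using mem_le c' a' assms le_trans[of "v \<otimes> x" c c'] by auto
        ultimately show ?thesis by simp
      qed
      then have vx: "v \<otimes> x \<preceq> c'" "i \<oplus> \<one> \<preceq> y \<longrightarrow> mem a b c (i \<oplus> \<one>) (v \<otimes> x)" by blast+
      have in': "i \<oplus> \<one> \<in> U" "v \<otimes> x \<in> U" using i a' assms by simp_all
      note ins = derivation_insert[OF b'(1) c'(1) y a'(1) b'(3) in' le vx(1) a'(3)]
      show "\<exists>a'\<in>U. \<exists>w\<in>U. derivation x ?y a' b' c' \<and> mem a' b' c' (i \<oplus> \<one>) w
          \<and> (i \<oplus> \<one> \<preceq> y \<longrightarrow> mem a b c (i \<oplus> \<one>) w)"
        using ins vx(2) i a' in' b' c'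
        by (intro bexI[of _ "a' \<otimes> modulus b' c' (i \<oplus> \<one>) (v \<otimes> x)"] bexI[of _ "v \<otimes> x"]) auto
    qed
  next
    show "env_in M ((\<lambda>_. \<zero>)(1 := x, 2 := y, 3 := a, 4 := b, 5 := c, 6 := b', 7 := c'))"
      using assms(1-6) b'(1) c'(1) by simp
    fix i assume "i \<in> U"
    then show "sat M ((\<lambda>_. \<zero>)(1 := x, 2 := y, 3 := a, 4 := b, 5 := c, 6 := b', 7 := c', 0 := i)) f
       \<longleftrightarrow> ?P i"
      using assms(1-6) b'(1) c'(1)
      by (simp add: f_def sat_derivationf sat_memf) (use zero_in in blast)
  qed (rule y)
  then show ?thesis using b' c' y by (auto simp: is_pow_def)
qed

section \<open>Uniqueness, totality and recursion of the power\<close>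

lemma is_pow_unique:
  assumes "x \<in> U" "y \<in> U" "z \<in> U" "z' \<in> U" "is_pow x y z" "is_pow x y z'" shows "z = z'"
proof -
  obtain a b c where *: "a \<in> U" "b \<in> U" "c \<in> U" "derivation x y a b c" "mem a b c y z"
    using assms(5) unfolding is_pow_def by blast
  obtain a' b' c' where **: "a' \<in> U" "b' \<in> U" "c' \<in> U" "derivation x y a' b' c'"
    "mem a' b' c' y z'"
    using assms(6) unfolding is_pow_def by blast
  show ?thesis
    using derivation_unique[OF assms(1,2) *(1-3) assms(2) **(1-3) *(4) **(4) assms(2)
        le_refl[OF assms(2)] le_refl[OF assms(2)] assms(3,4) *(5) **(5)] .
qed

lemma is_pow_zero:
  assumes "x \<in> U" shows "is_pow x \<zero> \<one>"
proof -
  \<comment> \<open>This is the largest index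
    \<open>y \<otimes> (c \<oplus> \<one>) \<oplus> (c \<oplus> \<one>)\<close> for
    \<open>y = \<zero>\<close> and \<open>c = \<one>\<close>.\<close>
  have "\<one> \<oplus> \<one> \<in> U" by simp
  from ex_common_multiple[OF this] obtain b where b: "b \<in> U" "b \<noteq> \<zero>"
    "\<forall>d\<in>U. d \<preceq> \<one> \<oplus> \<one> \<longrightarrow> d \<noteq> \<zero> \<longrightarrow> d divides b" by blast
  then show ?thesis
    unfolding is_pow_def using derivation_start[of b \<one> \<zero> x] by auto
qed

lemma ex_is_pow:
  assumes "x \<in> U" "y \<in> U" shows "\<exists>z\<in>U. is_pow x y z"
proof -
  have cl: "sat M ((\<lambda>_. \<zero>)(0 := x, 1 := a)) (Ex 2 powf) \<longleftrightarrow> (\<exists>z\<in>U. is_pow x a z)" if "a \<in> U" for a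
    using assms that by (simp add: sat_powf)
  show ?thesis
  proof (rule sigma1_induct[where i = 1 and a = y and e = "(\<lambda>_. \<zero>)(0 := x)" and f = "Ex 2 powf"])
    show "sigma1 (Ex 2 powf)" by (intro sigma1.intros(2) sigma1_powf)
    show "\<exists>z\<in>U. is_pow x \<zero> z" using is_pow_zero assms by blast
  next
    fix y assume "y \<in> U" "\<exists>z\<in>U. is_pow x y z"
    then show "\<exists>z\<in>U. is_pow x (y \<oplus> \<one>) z"
      using derivation_extend[OF assms(1)] unfolding is_pow_def[of x y] by blast
  qed (use assms cl in simp_all)
qed

lemma is_pow_succ:
  assumes "x \<in> U" "y \<in> U" "z \<in> U" "is_pow x (y \<oplus> \<one>) z"
  obtains w where "w \<in> U" "is_pow x y w" "z = w \<otimes> x"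
proof -
  from assms obtain a b c where abc: "a \<in> U" "b \<in> U" "c \<in> U" "derivation x (y \<oplus> \<one>) a b c"
    "mem a b c (y \<oplus> \<one>) z" unfolding is_pow_def by blast
  then obtain w where w: "w \<in> U" "z = w \<otimes> x" "mem a b c y w"
    using derivation_succ[OF abc(4) assms(2) le_refl] assms by auto
  have "derivation x y a b c" using derivation_mono[OF abc(4)] assms by simp
  with w abc that show thesis unfolding is_pow_def by blast
qed

text \<open>Totality lets a function be chosen; uniqueness identifies its graph with
  \<open>powf\<close>, which makes the graph \<open>sigma1\<close> and transfers the
  recursion.\<close>

lemma ex_isExp: "\<exists>E. isExp M E"
proof -
  obtain E where *: "\<forall>x\<in>U. \<forall>y\<in>U. E x y \<in> U \<and> is_pow x y (E x y)"
    using ex_is_pow by metis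
  then have E_in: "E x y \<in> U" and E_pow: "is_pow x y (E x y)" if "x \<in> U" "y \<in> U" for x y
    using that by blast+
  have E: "E x y = z \<longleftrightarrow> is_pow x y z" if "x \<in> U" "y \<in> U" "z \<in> U" for x y z
    using is_pow_unique[OF that(1,2) E_in[OF that(1,2)] that(3) E_pow[OF that(1,2)]]
      E_pow[OF that(1,2)] by auto
  have "isExp M E"
    unfolding isExp_def
  proof (intro conjI ballI)
    show "\<exists>f. sigma1 f \<and> (\<forall>e. env_in M e \<longrightarrow> (sat M e f \<longleftrightarrow> E (e 0) (e 1) = e 2))"
    proof (intro exI[of _ powf] conjI allI impI sigma1_powf)
      fix e assume e: "env_in M e"
      show "sat M e powf \<longleftrightarrow> E (e 0) (e 1) = e 2"
        using sat_powf[OF e] E[OF e[THEN env_in_app] e[THEN env_in_app] e[THEN env_in_app]] by simp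
    qed
  next
    fix x y assume xy: "x \<in> U" "y \<in> U"
    then have y: "y \<oplus> \<one> \<in> U" by simp
    obtain w where w: "w \<in> U" "is_pow x y w" "E x (y \<oplus> \<one>) = w \<otimes> x"
      using is_pow_succ[OF xy E_in[OF xy(1) y] E_pow[OF xy(1) y]] .
    moreover have "E x y = w" using E[OF xy w(1)] w(2) by blast
    ultimately show "E x (y \<oplus> \<one>) = E x y \<otimes> x" by simp
  next
    fix x assume "x \<in> U"
    then show "E x \<zero> = \<one>" using E[OF _ zero_in one_in] is_pow_zero by blast
  qed (rule E_in)
  then show ?thesis by blast
qed

subsection \<open>Standard powers and numerals\<close>

lemma num_in [simp]: "num k \<in> U"
  by (induction k) auto

lemma pow_in [simp]: "x \<in> U \<Longrightarrow> x \<up> k \<in> U"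
  by (induction k) auto

lemma num_mono: "m \<le> n \<Longrightarrow> num m \<preceq> num n"
proof (induction n)
  case (Suc n)
  then show ?case by (cases "m = Suc n") (auto simp: le_succ_iff)
qed simp

lemma num_add: "num (m + n) = num m \<oplus> num n"
  by (induction n) (simp_all add: add_assoc)

lemma num_mul: "num (m * n) = num m \<otimes> num n"
  by (induction n) (simp_all add: num_add mul_succ add_comm[of "num m"])

text \<open>Standard numerals form an initial segment, because nothing lies strictly between a
  number and its successor. This turns a bounded exponent into a standard one.\<close>

lemma le_num: "n \<in> U \<Longrightarrow> n \<preceq> num k \<Longrightarrow> \<exists>j\<le>k. n = num j"
proof (induction k)
  case (Suc k)
  then have "n \<preceq> num k \<or> n = num (Suc k)" by (simp add: le_succ_iff)
  then show ?case using Suc.IH[OF Suc.prems(1)] le_SucI by blast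
qed auto

lemma not_succ_le: "x \<in> U \<Longrightarrow> \<not> x \<oplus> \<one> \<preceq> x"
  using lt_iff[of x x] by (simp add: ltM_def)

lemma pow_add: "x \<in> U \<Longrightarrow> x \<up> (m + n) = x \<up> m \<otimes> x \<up> n"
  by (induction n) (simp_all add: mul_assoc)

lemma mul_pow: "x \<in> U \<Longrightarrow> y \<in> U \<Longrightarrow> (x \<otimes> y) \<up> n = x \<up> n \<otimes> y \<up> n"
  by (induction n) (simp_all add: mul_ac)

lemma pow_mult: "x \<in> U \<Longrightarrow> x \<up> (m * n) = (x \<up> m) \<up> n"
  by (induction n) (simp_all add: pow_add mul_comm)

lemma pow_mono: "x \<preceq> y \<Longrightarrow> x \<in> U \<Longrightarrow> y \<in> U \<Longrightarrow> x \<up> n \<preceq> y \<up> n"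
  by (induction n) (simp_all add: mul_mono)

lemma pow_neq_zero: "x \<in> U \<Longrightarrow> x \<noteq> \<zero> \<Longrightarrow> x \<up> n \<noteq> \<zero>"
  by (induction n) simp_all

lemma pow_le_pow: "x \<in> U \<Longrightarrow> x \<noteq> \<zero> \<Longrightarrow> m \<le> n \<Longrightarrow> x \<up> m \<preceq> x \<up> n"
  using le_mul[of "x \<up> m" "x \<up> (n - m)"] pow_neq_zero[of x "n - m"] pow_add[of x m "n - m"] by simp

lemma pow_less:
  assumes "x \<in> U" "y \<in> U" "x \<prec> y" "0 < n" shows "x \<up> n \<prec> y \<up> n"
proof -
  obtain k where k: "n = Suc k" using \<open>0 < n\<close> gr0_implies_Suc by blast
  have xy: "x \<oplus> \<one> \<preceq> y" using assms lt_iff[of x y] by simp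
  have "y \<noteq> \<zero>"
  proof
    assume "y = \<zero>" with xy assms(1) show False by simp
  qed
  then have "\<one> \<preceq> y \<up> k" using assms(2) pow_neq_zero one_le by simp
  moreover have "x \<up> k \<preceq> y \<up> k" using assms by (intro pow_mono) (simp_all add: ltM_def)
  ultimately have "x \<up> k \<otimes> x \<oplus> \<one> \<preceq> y \<up> k \<otimes> x \<oplus> y \<up> k"
    using assms(1,2) by (intro add_mono mul_mono) simp_all
  also have "\<dots> = y \<up> k \<otimes> (x \<oplus> \<one>)" using assms(1,2) by (simp add: mul_succ)
  finally have "x \<up> k \<otimes> x \<oplus> \<one> \<preceq> y \<up> k \<otimes> y"
    using mul_mono[of "y \<up> k" "y \<up> k" "x \<oplus> \<one>" y] xy assms(1,2)
      le_trans[of "x \<up> k \<otimes> x \<oplus> \<one>" "y \<up> k \<otimes> (x \<oplus> \<one>)" "y \<up> k \<otimes> y"] by simp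
  then show ?thesis using assms(1,2) lt_iff[of "x \<up> n" "y \<up> n"] k by simp
qed

lemma pow_le_cancel:
  assumes "x \<in> U" "y \<in> U" "x \<up> n \<preceq> y \<up> n" "0 < n" shows "x \<preceq> y"
  using assms pow_less[of y x n] not_le[of x y] not_le[of "x \<up> n" "y \<up> n"] by auto

lemma mul_le_cancel:
  assumes "x \<in> U" "y \<in> U" "z \<in> U" "z \<noteq> \<zero>" "x \<otimes> z \<preceq> y \<otimes> z" shows "x \<preceq> y"
proof (cases "y \<preceq> x")
  case True
  then have "y \<otimes> z \<preceq> x \<otimes> z" using assms mul_mono1 by blast
  then have "x \<otimes> z = y \<otimes> z" using assms(1-3,5) le_antisym by simp
  then have "x = y" using assms(1-4) mul_cancel_right by blast
  then show ?thesis using assms(1) by simp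
next
  case False then show ?thesis using assms le_total by blast
qed

text \<open>Each factor \<open>z\<close> at least doubles a positive number and so adds at least
  one.\<close>

lemma num_le_pow:
  assumes "z \<in> U" "z \<noteq> \<zero>" "z \<noteq> \<one>" shows "num (Suc k) \<preceq> z \<up> k"
proof (induction k)
  case (Suc k)
  have z: "\<one> \<oplus> \<one> \<preceq> z" using assms one_le lt_iff[of \<one> z] by (simp add: ltM_def)
  have "\<one> \<preceq> z \<up> k" using assms one_le pow_neq_zero by simp
  then have "num (Suc k) \<oplus> \<one> \<preceq> z \<up> k \<oplus> z \<up> k"
    using Suc assms(1) by (intro add_mono) simp_all
  also have "\<dots> = z \<up> k \<otimes> (\<one> \<oplus> \<one>)" using assms(1) by (simp add: distrib_left)
  finally show ?case
    using mul_mono[of "z \<up> k" "z \<up> k" "\<one> \<oplus> \<one>" z] z assms(1)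
      le_trans[of "num (Suc k) \<oplus> \<one>" "z \<up> k \<otimes> (\<one> \<oplus> \<one>)" "z \<up> k \<otimes> z"] by simp
qed simp

text \<open>In terms of roots: \<open>w\<close> is at most \<open>c^(1/(2r))\<close> for
  \<open>r = q + p\<close>, so \<open>d^r\<close> is at most \<open>c^(1/2)\<close>, hence at most
  \<open>c^(q/2)\<close>. The abc inequality leaves \<open>c^(q/2) \<le> K^q\<close>. As the model
  has no roots, everything is raised to the power \<open>6 * r\<close> and a factor
  cancelled.\<close>

lemma abc_bound:
  assumes "c \<in> U" "d \<in> U" "w \<in> U" "c \<noteq> \<zero>" "0 < q"
    and abc: "c \<up> q \<preceq> num K \<up> q \<otimes> d \<up> (q + p)"
    and "d \<preceq> w" and w: "w \<up> (6 * (q + p)) \<preceq> c \<up> 3"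
  shows "c \<preceq> num (K * K)"
proof -
  define r where "r = q + p"
  \<comment> \<open>Half of \<open>6 * q * r\<close>, the exponent of \<open>c\<close> once abc is
    raised to the power \<open>6 * r\<close>.\<close>
  define s where "s = 3 * q * r"
  have "d \<up> (r * (6 * r)) = (d \<up> (6 * r)) \<up> r"
    using assms(2) by (simp add: mult.commute[of r] flip: pow_mult)
  also have "\<dots> \<preceq> (w \<up> (6 * r)) \<up> r" using assms by (intro pow_mono) simp_all
  finally have 1: "d \<up> (r * (6 * r)) \<preceq> (w \<up> (6 * r)) \<up> r" .
  have 2: "(w \<up> (6 * r)) \<up> r \<preceq> c \<up> (3 * r)"
    using pow_mono[of "w \<up> (6 * r)" "c \<up> 3" r] w assms(1,3) by (simp only: pow_mult pow_in r_def)
  \<comment> \<open>Here \<open>q\<close> being positive gives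
    \<open>3 * r \<le> 3 * q * r\<close>.\<close>
  have 3: "c \<up> (3 * r) \<preceq> c \<up> s"
    using assms by (intro pow_le_pow) (simp_all add: s_def)
  from 1 2 3 have d: "d \<up> (r * (6 * r)) \<preceq> c \<up> s"
    using assms(1-3) le_trans[of "d \<up> (r * (6 * r))" "(w \<up> (6 * r)) \<up> r" "c \<up> (3 * r)"]
      le_trans[of "d \<up> (r * (6 * r))" "c \<up> (3 * r)" "c \<up> s"] by simp
  have eq: "q * (6 * r) = s + s" by (simp add: s_def)
  have "c \<up> s \<otimes> c \<up> s = (c \<up> q) \<up> (6 * r)"
    using assms(1) by (simp add: eq pow_add flip: pow_mult)
  also have "\<dots> \<preceq> (num K \<up> q \<otimes> d \<up> r) \<up> (6 * r)"
    using abc assms(1,2) by (intro pow_mono) (simp_all add: r_def)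
  also have "\<dots> = num K \<up> (s + s) \<otimes> d \<up> (r * (6 * r))"
    using assms(2) by (simp add: mul_pow eq flip: pow_mult)
  also have "num K \<up> (s + s) = num (K * K) \<up> s" by (simp add: pow_add num_mul mul_pow)
  finally have "c \<up> s \<otimes> c \<up> s \<preceq> num (K * K) \<up> s \<otimes> d \<up> (r * (6 * r))" .
  moreover have "\<dots> \<preceq> num (K * K) \<up> s \<otimes> c \<up> s"
    using d assms(1,2) by (intro mul_mono) simp_all
  ultimately have "c \<up> s \<otimes> c \<up> s \<preceq> num (K * K) \<up> s \<otimes> c \<up> s"
    using assms(1,2) le_trans[of "c \<up> s \<otimes> c \<up> s" "num (K * K) \<up> s \<otimes> d \<up> (r * (6 * r))"] by simp
  then have "c \<up> s \<preceq> num (K * K) \<up> s"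
    using assms(1,4) mul_le_cancel[of "c \<up> s" "num (K * K) \<up> s" "c \<up> s"] pow_neq_zero by simp
  then show ?thesis
    using assms(1,5) pow_le_cancel[of c "num (K * K)" s] by (simp add: s_def r_def)
qed

lemma isExp_num:
  assumes "isExp M E" "x \<in> U" shows "E x (num k) = x \<up> k"
  using assms by (induction k) (simp_all add: isExp_def)

end

subsection \<open>Fermat for the nonstandard exponential\<close>

locale isigma1_exp = isigma1 +
  fixes A :: "'a set" and ex :: "'a \<Rightarrow> 'a \<Rightarrow> 'a"
  assumes Exp: "ExpPrime M A ex" and e5': "e5' M A ex" and e8: "e8 M A ex"
begin

lemma presb: "presb_sub M A"
  using Exp by (simp add: ExpPrime_def)

lemma A_U: "x \<in> A \<Longrightarrow> x \<in> U"
proof -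
  have "A \<subseteq> U" using presb by (simp only: presb_sub_def)
  then show "x \<in> A \<Longrightarrow> x \<in> U" by blast
qed

lemma zero_A: "\<zero> \<in> A" and one_A: "\<one> \<in> A"
  and add_A: "x \<in> A \<Longrightarrow> y \<in> A \<Longrightarrow> x \<oplus> y \<in> A"
  and diff_A: "x \<in> A \<Longrightarrow> y \<in> A \<Longrightarrow> x \<preceq> y \<Longrightarrow> \<exists>z\<in>A. x \<oplus> z = y"
  using presb by (simp_all only: presb_sub_def)

lemma pred_A: "x \<in> A \<Longrightarrow> x \<noteq> \<zero> \<Longrightarrow> \<exists>z\<in>A. x = z \<oplus> \<one>"
proof -
  have "\<forall>x\<in>A. x \<noteq> \<zero> \<longrightarrow> (\<exists>z\<in>A. x = z \<oplus> \<one>)"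
    using presb unfolding presb_sub_def by (elim conjE)
  then show "x \<in> A \<Longrightarrow> x \<noteq> \<zero> \<Longrightarrow> \<exists>z\<in>A. x = z \<oplus> \<one>" by blast
qed

lemma ex_in [simp]: "x \<in> U \<Longrightarrow> y \<in> A \<Longrightarrow> ex x y \<in> U"
  and ex_eq_one: "x \<in> U \<Longrightarrow> y \<in> A \<Longrightarrow> x = \<one> \<or> y = \<zero> \<longleftrightarrow> ex x y = \<one>"
  and ex_neq_zero: "x \<in> U \<Longrightarrow> y \<in> A \<Longrightarrow> x \<noteq> \<zero> \<Longrightarrow> ex x y \<noteq> \<zero>"
  and ex_one: "x \<in> U \<Longrightarrow> ex x \<one> = x"
  and ex_add: "x \<in> U \<Longrightarrow> y \<in> A \<Longrightarrow> z \<in> A \<Longrightarrow> ex x (y \<oplus> z) = ex x y \<otimes> ex x z"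
  using Exp by (simp_all add: ExpPrime_def)

lemma ex_mul: "x \<in> U \<Longrightarrow> y \<in> U \<Longrightarrow> z \<in> A \<Longrightarrow> ex (x \<otimes> y) z = ex x z \<otimes> ex y z"
  using e5' by (simp add: e5'_def)

lemma ex_coprime:
  "x \<in> U \<Longrightarrow> y \<in> U \<Longrightarrow> a \<in> A \<Longrightarrow> b \<in> A \<Longrightarrow> coprimeM M x y \<Longrightarrow> coprimeM M (ex x a) (ex y b)"
  using e8 by (simp add: e8_def)

lemma num_A: "num k \<in> A"
  by (induction k) (simp_all add: zero_A one_A add_A)

text \<open>The induction is over standard naturals, so the laws for sums and for exponent one
  suffice, although \<open>ex\<close> is not definable.\<close>

lemma ex_num: "x \<in> U \<Longrightarrow> ex x (num k) = x \<up> k"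
proof (induction k)
  case 0 then show ?case using ex_eq_one[of x \<zero>] zero_A by simp
qed (simp_all add: num_A one_A ex_add ex_one)

text \<open>The remaining exponent lies in \<open>A\<close>, so (e4) splits off the standard power;
  the other factor is nonzero by (e2). This yields growth in place of a monotonicity law.\<close>

lemma pow_le_ex:
  assumes "x \<in> U" "x \<noteq> \<zero>" "n \<in> A" "num k \<preceq> n" shows "x \<up> k \<preceq> ex x n"
proof -
  obtain z where z: "z \<in> A" "num k \<oplus> z = n" using diff_A[OF num_A] assms by blast
  then have "ex x n = x \<up> k \<otimes> ex x z" using ex_add[of x "num k" z] ex_num num_A assms(1) by simp
  then show ?thesis using le_mul z(1) ex_neq_zero assms(1,2) by simp
qed

lemma dvd_ex:
  assumes "x \<in> U" "n \<in> A" "n \<noteq> \<zero>" shows "x divides ex x n"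
proof -
  obtain m where "m \<in> A" "n = m \<oplus> \<one>" using pred_A assms by blast
  then show ?thesis using assms(1) by (simp add: ex_add ex_one one_A)
qed

text \<open>After cancelling the power of a common factor, the power of the cofactor
  \<open>x'\<close> divides a number coprime to it by (e8). So it is one, and (e1) gives
  \<open>x' = \<one>\<close>.\<close>

lemma dvd_if_ex_dvd:
  assumes "x \<in> U" "x \<noteq> \<zero>" "z \<in> U" "n \<in> A" "n \<noteq> \<zero>" "ex x n divides ex z n"
  shows "x divides z"
proof -
  obtain g x' z' where g: "g \<in> U" "x' \<in> U" "z' \<in> U" "x = g \<otimes> x'" "z = g \<otimes> z'" "coprimeM M x' z'"
    using coprime_cofactors[OF assms(1,3,2)] .
  have nz: "ex g n \<noteq> \<zero>" using g assms ex_neq_zero by auto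
  obtain k where k: "k \<in> U" "ex z n = ex x n \<otimes> k" using assms(6) by (auto simp: dvdM_def)
  then have "ex g n \<otimes> ex z' n = ex g n \<otimes> (ex x' n \<otimes> k)"
    using g assms(4) by (simp add: ex_mul mul_assoc)
  then have "ex z' n = ex x' n \<otimes> k"
    using mul_cancel_left[OF _ _ _ nz] g(1-3) k(1) assms(4) by simp
  then have "ex x' n divides ex z' n" using k(1) by (auto simp: dvdM_def)
  moreover have "coprimeM M (ex x' n) (ex z' n)" using g assms ex_coprime by blast
  ultimately have "ex x' n = \<one>" using g assms(4) by (simp add: coprimeM_def)
  then have "x' = \<one>" using ex_eq_one[OF g(2) assms(4)] assms(5) by simp
  then show ?thesis using g by simp
qed

lemma isRad_ex:
  assumes "w \<in> U" "n \<in> A" "n \<noteq> \<zero>" "isRad M w d" shows "isRad M (ex w n) d"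
proof -
  have d: "d \<in> U" "squarefreeM M d" "d divides w"
    "\<And>p. p \<in> U \<Longrightarrow> primeM M p \<Longrightarrow> p divides w \<Longrightarrow> p divides d"
    using assms(4) by (auto simp: isRad_def)
  have "p divides w" if "p \<in> U" "primeM M p" "p divides ex w n" for p
  proof (rule ccontr)
    assume "\<not> p divides w"
    then have "coprimeM M p w" using prime_dvd_or_coprime that(1,2) by blast
    \<comment> \<open>(e8) with exponents one and \<open>n\<close>, since \<open>ex p \<one>\<close>
      is \<open>p\<close> itself.\<close>
    from ex_coprime[OF that(1) assms(1) one_A assms(2) this]
    have "coprimeM M p (ex w n)" using ex_one that(1) by simp
    then have "p = \<one>" using that(1,3) by (simp add: coprimeM_def)
    then show False using that(2) by (simp add: primeM_def)
  qed
  moreover have "d divides ex w n" using dvd_trans[OF d(3) dvd_ex] assms d(1) by blast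
  ultimately show ?thesis using d by (simp add: isRad_def)
qed

text \<open>The summands of the bound serve separately: \<open>6 * (q + p)\<close> is the power
  needed for \<open>abc_bound\<close>, and \<open>K * K\<close> is a power of \<open>z\<close> large
  enough to exceed the bound on \<open>c\<close> found there.\<close>

lemma exponent_bounded:
  assumes abc: "abc_holds M K p q" and "0 < q"
    and xyz: "x \<in> U" "y \<in> U" "z \<in> U" and nz: "x \<noteq> \<zero>" "y \<noteq> \<zero>" "z \<noteq> \<zero>"
    and "coprimeM M x y" and n: "n \<in> A" and eq: "ex x n \<oplus> ex y n = ex z n"
  shows "n \<preceq> num (6 * (q + p) + K * K)"
proof (rule ccontr)
  let ?N = "6 * (q + p) + K * K"
  assume "\<not> n \<preceq> num ?N"
  then have N: "num ?N \<preceq> n" using le_total n A_U num_in by blast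
  have Nk: "num k \<preceq> n" if "k \<le> ?N" for k
    using le_trans[OF num_mono[OF that] N] n A_U by simp
  have n0: "n \<noteq> \<zero>" using \<open>\<not> n \<preceq> num ?N\<close> by auto
  define a b c where abc_def: "a = ex x n" "b = ex y n" "c = ex z n"
  have U: "a \<in> U" "b \<in> U" "c \<in> U" using xyz n by (simp_all add: abc_def)
  have abc0: "a \<noteq> \<zero>" "b \<noteq> \<zero>" "c \<noteq> \<zero>" using xyz nz n ex_neq_zero by (simp_all add: abc_def)
  have ab: "a \<oplus> b = c" using eq by (simp add: abc_def)
  have c_ab: "coprimeM M a b" using ex_coprime assms by (simp add: abc_def)
  \<comment> \<open>A common divisor of \<open>b\<close> and \<open>a \<oplus> b\<close> divides
    \<open>a\<close>.\<close>
  have c_bc: "coprimeM M b c"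
    using c_ab dvd_add_cancel2[of _ a b] U unfolding coprimeM_def ab[symmetric] by blast
  have c_ac: "coprimeM M a c"
    using c_ab dvd_add_cancel[of _ a b] U unfolding coprimeM_def ab[symmetric] by blast
  define w where "w = x \<otimes> y \<otimes> z"
  have w: "w \<in> U" "w \<noteq> \<zero>" using xyz nz by (simp_all add: w_def)
  obtain d where d: "isRad M w d" using ex_rad w by blast
  have "isRad M (ex w n) d" by (rule isRad_ex[OF w(1) n n0 d])
  then have rad: "isRad M (a \<otimes> b \<otimes> c) d"
    using xyz n by (simp add: w_def abc_def ex_mul)
  have dU: "d \<in> U" "d \<preceq> w" using d dvd_le w by (auto simp: isRad_def)
  have "c \<up> q \<prec> num K \<up> q \<otimes> d \<up> (q + p)"
    using abc c_ab c_bc c_ac ab rad U dU unfolding abc_holds_def by blast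
  then have le: "c \<up> q \<preceq> num K \<up> q \<otimes> d \<up> (q + p)" by (simp add: ltM_def)
  have "a \<preceq> c" "b \<preceq> c" using U le_add1[of a b] le_add2[of b a] by (simp_all add: ab)
  moreover have "x \<up> (6 * (q + p)) \<preceq> a" "y \<up> (6 * (q + p)) \<preceq> b" "z \<up> (6 * (q + p)) \<preceq> c"
    using pow_le_ex xyz nz n Nk unfolding abc_def by simp_all
  ultimately have "x \<up> (6 * (q + p)) \<otimes> y \<up> (6 * (q + p)) \<otimes> z \<up> (6 * (q + p)) \<preceq> c \<otimes> c \<otimes> c"
    using U xyz le_trans[of "x \<up> (6 * (q + p))" a c] le_trans[of "y \<up> (6 * (q + p))" b c]
    by (intro mul_mono) simp_all
  then have "w \<up> (6 * (q + p)) \<preceq> c \<up> 3"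
    using U xyz by (simp add: w_def mul_pow eval_nat_numeral)
  then have cK: "c \<preceq> num (K * K)"
    using abc_bound[OF U(3) dU(1) w(1) abc0(3) \<open>0 < q\<close> le dU(2)] by blast
  \<comment> \<open>Powers of one do not grow; but \<open>z = \<one>\<close> would give
    \<open>c = \<one>\<close>, while \<open>c\<close> is a sum of two nonzero numbers.\<close>
  have "z \<noteq> \<one>"
  proof
    assume "z = \<one>"
    then have "c = \<one>" using ex_eq_one[OF one_in n] by (simp add: abc_def)
    moreover have "\<one> \<oplus> \<one> \<preceq> a \<oplus> b" using one_le abc0 U by (intro add_mono) simp_all
    ultimately show False using ab not_succ_le[OF one_in] by simp
  qed
  then have "num (Suc (K * K)) \<preceq> z \<up> (K * K)" using num_le_pow xyz nz by blast
  moreover have "z \<up> (K * K) \<preceq> c" using pow_le_ex xyz nz n Nk unfolding abc_def by simp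
  ultimately have "num (Suc (K * K)) \<preceq> c"
    by (rule le_trans) (rule num_in U(3) pow_in[OF xyz(3)])+
  then have "num (Suc (K * K)) \<preceq> num (K * K)" using cK by (rule le_trans) (rule num_in U(3))+
  then show False using not_succ_le[OF num_in] by simp
qed

lemma flt_e_if_abc:
  assumes abc: "abc_holds M K p q" and "0 < q" and flt: "flt_exp M"
  shows "flt_e M A ex"
  unfolding flt_e_def
proof (intro notI, elim bexE conjE)
  fix x y z n assume xyz: "x \<in> U" "y \<in> U" "z \<in> U" and nz: "x \<noteq> \<zero>" "y \<noteq> \<zero>" "z \<noteq> \<zero>"
    and n: "n \<in> A" and n2: "num 2 \<prec> n" and eq: "ex x n \<oplus> ex y n = ex z n"
  have n0: "n \<noteq> \<zero>"
  proof
    assume "n = \<zero>"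
    then have "num 2 = \<zero>" using n2 le_zero[OF num_in[of 2]] by (simp only: ltM_def)
    then show False by (simp add: eval_nat_numeral)
  qed
  obtain g x' y' where g: "g \<in> U" "x' \<in> U" "y' \<in> U" "x = g \<otimes> x'" "y = g \<otimes> y'" "coprimeM M x' y'"
    using coprime_cofactors[OF xyz(1,2) nz(1)] .
  have g0: "g \<noteq> \<zero>" "x' \<noteq> \<zero>" "y' \<noteq> \<zero>" using g nz by auto
  \<comment> \<open>The third base shares the factor \<open>g\<close>: its power divides the sum,
    which is \<open>ex z n\<close>.\<close>
  have "ex g n divides ex x n \<oplus> ex y n" using g n by (intro dvd_add) (simp_all add: ex_mul)
  then have "g divides z" using dvd_if_ex_dvd[OF g(1) g0(1) xyz(3) n n0] eq by simp
  then obtain z' where z': "z' \<in> U" "z = g \<otimes> z'" by (auto simp: dvdM_def)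
  have z0: "z' \<noteq> \<zero>" using z' nz g by auto
  have "ex g n \<otimes> (ex x' n \<oplus> ex y' n) = ex g n \<otimes> ex z' n"
    using eq g z' n by (simp add: ex_mul distrib_left)
  then have eq': "ex x' n \<oplus> ex y' n = ex z' n"
    using mul_cancel_left[of "ex x' n \<oplus> ex y' n" "ex z' n" "ex g n"] g(1-3) z'(1) n ex_neq_zero[OF g(1) n g0(1)] by simp
  have "n \<preceq> num (6 * (q + p) + K * K)"
    by (rule exponent_bounded[OF abc \<open>0 < q\<close> g(2,3) z'(1) g0(2,3) z0 g(6) n eq'])
  then obtain k where k: "n = num k" using le_num[OF A_U[OF n]] by blast
  obtain E where E: "isExp M E" using ex_isExp by blast
  \<comment> \<open>The reduced solution served only to bound \<open>n\<close>. With
    \<open>n\<close> standard, both exponentials are the ordinary power, and the original solution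
    contradicts FLT for \<open>E\<close>.\<close>
  have "E x n \<oplus> E y n = E z n"
    using eq isExp_num[OF E] ex_num xyz by (simp add: k)
  moreover have "E x n \<oplus> E y n \<noteq> E z n"
    using flt[unfolded flt_exp_def, rule_format, OF E xyz A_U[OF n]] nz n2 by blast
  ultimately show False by contradiction
qed

end

theorem theorem6p1:
  fixes T :: "fm set" and K p q :: nat
  assumes ext: "\<forall>M :: 'a lstr. models M T \<longrightarrow> ISigma1 M"
    and eps: "0 < p" "0 < q"
    and abc: "\<forall>M :: 'a lstr. models M T \<longrightarrow> abc_holds M K p q"
    and flt: "\<forall>M :: 'a lstr. models M T \<longrightarrow> flt_exp M"
  shows "\<forall>(M :: 'a lstr) A e. models M T \<and> ExpPrime M A e \<and> e5' M A e \<and> e8 M A e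
           \<longrightarrow> flt_e M A e"
proof (intro allI impI, elim conjE)
  fix M :: "'a lstr" and A e
  assume M: "models M T" and e: "ExpPrime M A e" "e5' M A e" "e8 M A e"
  have "ISigma1 M" by (rule ext[rule_format, OF M])
  then have "isigma1_exp M A e"
    using e by (simp add: isigma1_exp_def isigma1_def isigma1_exp_axioms_def)
  then show "flt_e M A e"
    by (rule isigma1_exp.flt_e_if_abc[OF _ abc[rule_format, OF M] eps(2) flt[rule_format, OF M]])
qed

end
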